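(* An infinite word $\alpha$ is determined by some indexed language if and only if $\alpha$ is morphic.
   Context: Indexed languages are the languages generated by indexed grammars (Aho's grammars in which nonterminals carry stacks that can be pushed, popped and copied). A language $L$ determines an infinite word $\alpha$ iff $L$ is infinite and every $x\in L$ is a prefix of $\alpha$. A morphism $h$ on an alphabet $A$ is a map $A^*\to A^*$ with $h(xy)=h(x)h(y)$; it is a coding if $|h(a)|=1$ for all $a\in A$. A string $x$ is mortal for $h$ if $h^m(x)$ is empty for some $m\ge0$. $h$ is prolongable on $a\in A$ if $h(a)=ax$ with $x$ not mortal; then $h^\omega(a)$ denotes the infinite word $a\,x\,h(x)\,h^2(x)\cdots$. An infinite word $\alpha$ is morphic if there are a morphism $h$, a coding $e$ and a symbol $a$ with $h$ prolongable on $a$ and $\alpha=e(h^\omega(a))$. *)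

theory Defs
  imports Main
begin

section \<open>Indexed grammars (Aho), in the Hopcroft--Ullman normal form\<close>

datatype ('n,'t) sym = NT 'n | Tm 't

text \<open>Productions: A -> alpha (stack copied to every nonterminal of alpha);
  A -> B f (push index f); A f -> alpha (pop index f, copy the rest).\<close>
datatype ('n,'t,'i) prod =
    Copy 'n "('n,'t) sym list"
  | Push 'n 'n 'i
  | Pop 'n 'i "('n,'t) sym list"

datatype ('n,'t,'i) item = Var 'n "'i list" | Ter 't

fun inst :: "'i list \<Rightarrow> ('n,'t) sym \<Rightarrow> ('n,'t,'i) item" where
  "inst \<gamma> (NT B) = Var B \<gamma>"
| "inst \<gamma> (Tm a) = Ter a"

inductive istep :: "('n,'t,'i) prod set \<Rightarrow> ('n,'t,'i) item list \<Rightarrow> ('n,'t,'i) item list \<Rightarrow> bool"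
  for P where
  copy: "Copy A \<alpha> \<in> P \<Longrightarrow> istep P (u @ [Var A \<gamma>] @ w) (u @ map (inst \<gamma>) \<alpha> @ w)"
| push: "Push A B f \<in> P \<Longrightarrow> istep P (u @ [Var A \<gamma>] @ w) (u @ [Var B (f # \<gamma>)] @ w)"
| pop: "Pop A f \<alpha> \<in> P \<Longrightarrow> istep P (u @ [Var A (f # \<gamma>)] @ w) (u @ map (inst \<gamma>) \<alpha> @ w)"

definition ilang :: "('n,'t,'i) prod set \<Rightarrow> 'n \<Rightarrow> 't list set" where
  "ilang P S = {x. (istep P)\<^sup>*\<^sup>* [Var S []] (map Ter x)}"

text \<open>Indexed languages: generated by an indexed grammar with finitely many
  productions; nonterminals and index symbols are taken from nat (w.l.o.g.).\<close>
definition indexed_language :: "'t list set \<Rightarrow> bool" where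
  "indexed_language L \<longleftrightarrow>
     (\<exists>(P :: (nat,'t,nat) prod set) S. finite P \<and> L = ilang P S)"

definition is_prefix_of_word :: "'t list \<Rightarrow> (nat \<Rightarrow> 't) \<Rightarrow> bool" where
  "is_prefix_of_word x \<alpha> \<longleftrightarrow> (\<forall>i < length x. x ! i = \<alpha> i)"

definition determines :: "'t list set \<Rightarrow> (nat \<Rightarrow> 't) \<Rightarrow> bool" where
  "determines L \<alpha> \<longleftrightarrow> infinite L \<and> (\<forall>x \<in> L. is_prefix_of_word x \<alpha>)"

definition hext :: "('a \<Rightarrow> 'a list) \<Rightarrow> 'a list \<Rightarrow> 'a list" where
  "hext h x = concat (map h x)"

definition mortal :: "('a \<Rightarrow> 'a list) \<Rightarrow> 'a list \<Rightarrow> bool" where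
  "mortal h x \<longleftrightarrow> (\<exists>m. (hext h ^^ m) x = [])"

definition prolongable :: "('a \<Rightarrow> 'a list) \<Rightarrow> 'a \<Rightarrow> bool" where
  "prolongable h a \<longleftrightarrow> (\<exists>x. h a = a # x \<and> \<not> mortal h x)"

text \<open>h^omega(a) = a x h(x) h^2(x) ..., the limit of the words h^n(a).\<close>
definition omega_iter :: "('a \<Rightarrow> 'a list) \<Rightarrow> 'a \<Rightarrow> nat \<Rightarrow> 'a" where
  "omega_iter h a i = (hext h ^^ (LEAST n. i < length ((hext h ^^ n) [a]))) [a] ! i"

text \<open>Morphic: a morphism h on a finite alphabet A (taken inside nat, w.l.o.g.),
  a coding e (letter-to-letter map), and a in A with h prolongable on a.\<close>
definition morphic :: "(nat \<Rightarrow> 't) \<Rightarrow> bool" where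
  "morphic \<alpha> \<longleftrightarrow> (\<exists>(A :: nat set) (h :: nat \<Rightarrow> nat list) (e :: nat \<Rightarrow> 't) a.
      finite A \<and> a \<in> A \<and> (\<forall>b \<in> A. set (h b) \<subseteq> A) \<and>
      prolongable h a \<and> \<alpha> = (\<lambda>i. e (omega_iter h a i)))"

end

theory Submission
  imports Defs
begin

text \<open>
  Suppose an indexed grammar generates arbitrarily long words. A long word has a derivation
  tree containing a path with many branchings, i.e. nodes with a further child of nonempty
  yield. Read such a path as a run of a pushdown automaton, completed by letting the final
  terminal symbol pop the remaining stack. Nesting the matching pushes and pops and comparing,
  at each level, the two symbols involved and the sets of nonterminals that derive some word or
  some nonempty word from the current stack, the pigeonhole principle yields a repetition
  with a branching strictly in between: \<open>X\<gamma>\<close> derives \<open>u X\<delta>\<gamma> v\<close> and \<open>Y\<delta>\<close> derives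
  \<open>u' Y v'\<close>, where u v or u' v' contributes letters, and every other productive nonterminal B
  over \<open>\<delta>\<gamma>\<close> derives a word of productive nonterminals over \<open>\<gamma>\<close>. Pumping \<open>\<delta>\<close> gives words
  \<open>g (h\<^sup>n w)\<close> of the language, of unbounded length, for two morphisms g and h.

  If all words \<open>g (h\<^sup>n w)\<close> are prefixes of \<open>\<alpha>\<close>, then after passing to a power of h and deleting
  letters that never contribute, h and g are nonerasing and h is idempotent on letters with
  bounded iterates. The first letter c with unbounded iterates then recurs, \<open>h c = s c r\<close> with s
  bounded: if s is empty, h is prolongable on c, and otherwise \<open>\<alpha>\<close> is ultimately periodic.

  Conversely, the words \<open>e (h\<^sup>n a)\<close> are generated by a grammar that pushes n indices and
  applies h whenever one of them is popped.
\<close>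

section \<open>Prefixes of infinite words\<close>

lemma is_prefix_of_word_append:
  "is_prefix_of_word (x @ y) \<alpha> \<longleftrightarrow>
     is_prefix_of_word x \<alpha> \<and> (\<forall>i < length y. y ! i = \<alpha> (length x + i))"
proof -
  have "(\<forall>i < length x + length y. (x @ y) ! i = \<alpha> i) \<longleftrightarrow>
     (\<forall>i < length x. x ! i = \<alpha> i) \<and> (\<forall>i < length y. y ! i = \<alpha> (length x + i))"
    (is "?l \<longleftrightarrow> ?r")
  proof
    assume l: ?l
    show ?r
    proof (intro conjI allI impI)
      fix i assume "i < length x"
      then show "x ! i = \<alpha> i" using l[rule_format, of i] by (simp add: nth_append)
    next
      fix i assume "i < length y"
      then show "y ! i = \<alpha> (length x + i)" using l[rule_format, of "length x + i"]
        by (simp add: nth_append)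
    qed
  next
    assume r: ?r
    show ?l
    proof (intro allI impI)
      fix i assume i: "i < length x + length y"
      show "(x @ y) ! i = \<alpha> i"
        using r i r[THEN conjunct2, rule_format, of "i - length x"]
        by (cases "i < length x") (auto simp: nth_append)
    qed
  qed
  then show ?thesis by (simp add: is_prefix_of_word_def)
qed

lemma is_prefix_of_word_appendD1: "is_prefix_of_word (x @ y) \<alpha> \<Longrightarrow> is_prefix_of_word x \<alpha>"
  by (simp add: is_prefix_of_word_append)

section \<open>Iterated morphisms\<close>

lemma hext_simps [simp]:
  "hext h [] = []" "hext h (b # x) = h b @ hext h x" "hext h (x @ y) = hext h x @ hext h y"
  by (simp_all add: hext_def)

lemma hext_pow_Nil [simp]: "(hext h ^^ n) [] = []"
  by (induction n) auto

lemma hext_pow_append: "(hext h ^^ n) (x @ y) = (hext h ^^ n) x @ (hext h ^^ n) y"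
  by (induction n) auto

lemma hext_pow_Cons: "(hext h ^^ n) (b # x) = (hext h ^^ n) [b] @ (hext h ^^ n) x"
  using hext_pow_append[of n h "[b]" x] by simp

lemma hext_pow_add: "(hext h ^^ (m + n)) x = (hext h ^^ m) ((hext h ^^ n) x)"
  by (simp add: funpow_add)

lemma hext_pow_Suc_right: "(hext h ^^ Suc n) x = (hext h ^^ n) (hext h x)"
  by (simp add: funpow_swap1)

lemma set_hext: "set (hext h x) = (\<Union>b\<in>set x. set (h b))"
  by (auto simp: hext_def)

lemma set_hext_pow_subset:
  assumes "\<forall>b\<in>A. set (h b) \<subseteq> A" "set x \<subseteq> A"
  shows "set ((hext h ^^ n) x) \<subseteq> A"
  using assms by (induction n) (fastforce simp: set_hext)+

text \<open>A power of \<open>h\<close> as a letter map again, so that results about morphisms apply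
  to powers as well.\<close>

definition hpow :: "('a \<Rightarrow> 'a list) \<Rightarrow> nat \<Rightarrow> 'a \<Rightarrow> 'a list" where
  "hpow h N b = (hext h ^^ N) [b]"

lemma hext_hpow: "hext (hpow h N) x = (hext h ^^ N) x"
proof (induction x)
  case (Cons b x)
  then show ?case using hext_pow_Cons[of N h b x] by (simp add: hpow_def)
qed simp

lemma hext_hpow_pow: "(hext (hpow h N) ^^ n) x = (hext h ^^ (N * n)) x"
proof -
  have "hext (hpow h N) = hext h ^^ N" by (rule ext) (rule hext_hpow)
  then show ?thesis by (simp add: funpow_mult)
qed

lemma length_le_hext:
  assumes "\<forall>b\<in>A. h b \<noteq> []" "set x \<subseteq> A"
  shows "length x \<le> length (hext h x)"
  using assms(2)
proof (induction x)
  case (Cons b x)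
  then have "h b \<noteq> []" using assms(1) by auto
  then show ?case using Cons by (cases "h b") auto
qed simp

lemma length_hext_pow_mono:
  assumes "\<forall>b\<in>A. set (h b) \<subseteq> A \<and> h b \<noteq> []" "set x \<subseteq> A" "m \<le> n"
  shows "length ((hext h ^^ m) x) \<le> length ((hext h ^^ n) x)"
  using assms(3)
proof (induction n rule: dec_induct)
  case (step n)
  have "set ((hext h ^^ n) x) \<subseteq> A" using assms by (intro set_hext_pow_subset) auto
  then show ?case using step length_le_hext[of A h "(hext h ^^ n) x"] assms(1) by fastforce
qed simp

lemma prolongable_length:
  assumes "prolongable h a"
  shows "n < length ((hext h ^^ n) [a])"
proof -
  obtain x where x: "h a = a # x" "\<not> mortal h x" using assms by (auto simp: prolongable_def)
  show ?thesis
  proof (induction n)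
    case (Suc n)
    have "(hext h ^^ Suc n) [a] = (hext h ^^ n) [a] @ (hext h ^^ n) x"
      using x(1) hext_pow_Cons[of n h a x] by (simp add: hext_pow_Suc_right del: funpow.simps)
    moreover have "(hext h ^^ n) x \<noteq> []" using x(2) by (auto simp: mortal_def)
    ultimately show ?case using Suc length_greater_0_conv[of "(hext h ^^ n) x"]
      by (simp del: funpow.simps length_greater_0_conv)
  qed simp
qed

text \<open>Iterates on a prolongable letter grow without bound, so the iterate selected by
  \<open>omega_iter\<close> reaches position \<open>i\<close>, and its coded image is a prefix of
  \<alpha>.\<close>

lemma omega_iter_eq:
  assumes "prolongable h a" "\<And>n. is_prefix_of_word (map e ((hext h ^^ n) [a])) \<alpha>"
  shows "\<alpha> = (\<lambda>i. e (omega_iter h a i))"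
proof
  fix i
  let ?n = "LEAST n. i < length ((hext h ^^ n) [a])"
  have "i < length ((hext h ^^ ?n) [a])"
    using prolongable_length[OF assms(1), of i] by (rule LeastI)
  then show "\<alpha> i = e (omega_iter h a i)"
    using assms(2)[of ?n] by (auto simp: is_prefix_of_word_def omega_iter_def)
qed

text \<open>Since \<open>h a = a # x\<close>, each iterate is the preceding one followed by an image
  of \<open>x\<close>. Hence all iterates agree with the one selected by
  \<open>LEAST\<close>.\<close>

lemma is_prefix_omega_iter:
  assumes "prolongable h a"
  shows "is_prefix_of_word ((hext h ^^ n) [a]) (omega_iter h a)"
proof -
  obtain x where x: "h a = a # x" using assms by (auto simp: prolongable_def)
  have app: "\<exists>y. (hext h ^^ (m + d)) [a] = (hext h ^^ m) [a] @ y" for m d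
  proof (induction d)
    case (Suc d)
    have "(hext h ^^ (m + Suc d)) [a] = (hext h ^^ (m + d)) [a] @ (hext h ^^ (m + d)) x"
      using x hext_pow_Cons[of "m + d" h a x] by (simp add: hext_pow_Suc_right del: funpow.simps)
    then show ?case using Suc by auto
  qed auto
  show ?thesis unfolding is_prefix_of_word_def
  proof (intro allI impI)
    fix i assume i: "i < length ((hext h ^^ n) [a])"
    let ?m = "LEAST n. i < length ((hext h ^^ n) [a])"
    have m: "i < length ((hext h ^^ ?m) [a])" using i by (rule LeastI)
    have "?m \<le> n" using i by (rule Least_le)
    then obtain y where "(hext h ^^ n) [a] = (hext h ^^ ?m) [a] @ y"
      using app[of ?m "n - ?m"] by auto
    then show "(hext h ^^ n) [a] ! i = omega_iter h a i"
      using m by (simp add: omega_iter_def nth_append)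
  qed
qed

text \<open>\<open>morphic\<close> asks for an alphabet of natural numbers. An injection \<phi> of
  the finite alphabet into \<open>nat\<close> carries the morphism over, and the coding is composed
  with its inverse \<psi>.\<close>

lemma morphicI:
  fixes h :: "'b \<Rightarrow> 'b list" and e :: "'b \<Rightarrow> 't"
  assumes fin: "finite A" and a: "a \<in> A" and cl: "\<forall>b\<in>A. set (h b) \<subseteq> A" and pr: "prolongable h a"
    and pre: "\<And>n. is_prefix_of_word (map e ((hext h ^^ n) [a])) \<alpha>"
  shows "morphic \<alpha>"
proof -
  obtain \<phi> :: "'b \<Rightarrow> nat" where inj: "inj_on \<phi> A"
    using finite_imp_inj_to_nat_seg[OF fin] by blast
  define \<psi> where "\<psi> = inv_into A \<phi>"
  have \<psi>: "\<psi> (\<phi> b) = b" if "b \<in> A" for b using that inj by (simp add: \<psi>_def)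
  define k where "k = (\<lambda>n. map \<phi> (h (\<psi> n)))"
  have hx: "hext k (map \<phi> x) = map \<phi> (hext h x)" if "set x \<subseteq> A" for x
    using that by (induction x) (auto simp: k_def \<psi>)
  have kp: "(hext k ^^ n) (map \<phi> x) = map \<phi> ((hext h ^^ n) x)" if "set x \<subseteq> A" for n x
    using set_hext_pow_subset[OF cl that] by (induction n) (auto simp: hx)
  obtain x where x: "h a = a # x" "\<not> mortal h x" using pr by (auto simp: prolongable_def)
  have xA: "set x \<subseteq> A" using x(1) cl a by force
  have prk: "prolongable k (\<phi> a)"
    unfolding prolongable_def
  proof (intro exI conjI)
    show "k (\<phi> a) = \<phi> a # map \<phi> x" using x(1) a by (simp add: k_def \<psi>)
    show "\<not> mortal k (map \<phi> x)" using x(2) xA by (auto simp: mortal_def kp)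
  qed
  have "map (e \<circ> \<psi>) ((hext k ^^ n) [\<phi> a]) = map e ((hext h ^^ n) [a])" for n
    using kp[of "[a]" n] a set_hext_pow_subset[OF cl, of "[a]" n] by (auto intro!: \<psi> arg_cong[where f=e])
  then have "\<alpha> = (\<lambda>i. (e \<circ> \<psi>) (omega_iter k (\<phi> a) i))"
    by (intro omega_iter_eq prk) (simp only: pre)
  moreover have "\<forall>b\<in>\<phi> ` A. set (k b) \<subseteq> \<phi> ` A" using cl by (auto simp: k_def \<psi>)
  ultimately show ?thesis unfolding morphic_def
    using fin a prk by (intro exI[of _ "\<phi> ` A"] exI[of _ k] exI[of _ "e \<circ> \<psi>"] exI[of _ "\<phi> a"]) auto
qed

section \<open>Limits of images of iterated morphisms are morphic\<close>

text \<open>To replace g by a coding, the letter b becomes the block \<open>(b, 0), \<dots>, (b, |g b| - 1)\<close>, whose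
  first letter is mapped to the blocks of \<open>k b\<close> while the others are erased. The fresh first
  letter None takes care of the prefix y.\<close>

lemma morphic_if_prolongable:
  fixes k :: "'a \<Rightarrow> 'a list" and g :: "'a \<Rightarrow> 't list"
  assumes fin: "finite A" and kA: "\<forall>b\<in>A. set (k b) \<subseteq> A \<and> k b \<noteq> [] \<and> g b \<noteq> []"
    and c: "c \<in> A" "k c = c # r" "r \<noteq> []"
    and pre: "\<And>n. is_prefix_of_word (y @ concat (map g ((hext k ^^ n) [c]))) \<alpha>"
  shows "morphic \<alpha>"
proof -
  define k' where "k' = (\<lambda>b. case b of None \<Rightarrow> None # map Some r | Some b \<Rightarrow> map Some (k b))"
  define g' where "g' = (\<lambda>b. case b of None \<Rightarrow> y @ g c | Some b \<Rightarrow> g b)"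
  define A' where "A' = insert None (Some ` A)"
  have rA: "set r \<subseteq> A" using c kA by force
  have A': "\<forall>b\<in>A'. set (k' b) \<subseteq> A'" "\<forall>b\<in>A'. g' b \<noteq> []" "\<forall>b\<in>A'. k' b \<noteq> []"
    using kA rA c by (auto simp: k'_def g'_def A'_def)
  have k'S: "(hext k' ^^ n) (map Some x) = map Some ((hext k ^^ n) x)" for n x
  proof (induction n)
    case (Suc n)
    have "hext k' (map Some z) = map Some (hext k z)" for z by (induction z) (auto simp: k'_def)
    then show ?case using Suc by simp
  qed simp
  have k'N: "\<exists>z. (hext k ^^ n) [c] = c # z \<and> (hext k' ^^ n) [None] = None # map Some z" for n
  proof (induction n)
    case (Suc n)
    then obtain z where z: "(hext k ^^ n) [c] = c # z" "(hext k' ^^ n) [None] = None # map Some z"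
      by blast
    have "hext k' (map Some z) = map Some (hext k z)" using k'S[of 1 z] by simp
    then show ?case using z c by (auto simp: k'_def)
  qed simp
  define block where "block = (\<lambda>b. map (Pair b) [0..<length (g' b)])"
  define K where "K = (\<lambda>(b, i::nat). if i = 0 then concat (map block (k' b)) else [])"
  define e where "e = (\<lambda>(b, i). g' b ! i)"
  define B where "B = (\<Union>b\<in>A'. set (block b))"
  have block: "block b = (b, 0) # map (Pair b) [1..<length (g' b)]" if "b \<in> A'" for b
  proof -
    have "0 < length (g' b)" using A'(2) that by blast
    then show ?thesis by (simp add: block_def upt_conv_Cons)
  qed
  \<comment> \<open>Only the first letter of a block carries an image and the others are erased, so
    a block is mapped like the letter it stands for.\<close>
  have tail: "hext K (map (Pair b) xs) = []" if "0 \<notin> set xs" for b xs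
    using that by (induction xs) (auto simp: K_def)
  have Kblock: "hext K (block b) = concat (map block (k' b))" if "b \<in> A'" for b
    using block[OF that] tail[of "[1..<length (g' b)]" b] by (simp add: K_def)
  have Kblocks: "hext K (concat (map block x)) = concat (map block (hext k' x))" if "set x \<subseteq> A'" for x
    using that by (induction x) (auto simp: Kblock)
  have Kpow: "(hext K ^^ n) (concat (map block x)) = concat (map block ((hext k' ^^ n) x))"
    if "set x \<subseteq> A'" for n x
    using set_hext_pow_subset[OF A'(1) that] by (induction n) (auto simp: Kblocks)
  have eb: "map e (concat (map block x)) = concat (map g' x)" for x
    by (induction x) (auto simp: block_def e_def comp_def map_nth)
  have NA: "None \<in> A'" by (simp add: A'_def)
  \<comment> \<open>What remains of the image of the start letter: the erased letters of its own
    block, then the blocks of \<open>r\<close>.\<close>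
  define x where "x = map (Pair None) [1..<length (g' None)] @ concat (map block (map Some r))"
  have Kx: "K (None, 0) = (None, 0) # x"
    using block[OF NA] by (simp add: K_def k'_def x_def)
  have rA': "set (map Some r) \<subseteq> A'" using rA by (auto simp: A'_def)
  have len: "length z \<le> length (concat (map block z))" if "set z \<subseteq> A'" for z
    using that block by (induction z) auto
  \<comment> \<open>One application removes the erased letters of \<open>x\<close>. What is left are
    the blocks of the iterates on \<open>r\<close>, which never become empty because
    \<open>k\<close> is nonerasing.\<close>
  have "(hext K ^^ Suc n) x \<noteq> []" for n
  proof -
    have "hext K x = hext K (concat (map block (map Some r)))"
      unfolding x_def using tail[of "[1..<length (g' None)]" None] by simp
    then have "(hext K ^^ Suc n) x = (hext K ^^ Suc n) (concat (map block (map Some r)))"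
      by (simp add: hext_pow_Suc_right del: funpow.simps)
    also have "\<dots> = concat (map block ((hext k' ^^ Suc n) (map Some r)))"
      by (rule Kpow[OF rA'])
    finally have "length ((hext k' ^^ Suc n) (map Some r)) \<le> length ((hext K ^^ Suc n) x)"
      using len[OF set_hext_pow_subset[OF A'(1) rA'], of "Suc n"] by (simp del: funpow.simps)
    moreover have "length ((hext k' ^^ 0) (map Some r)) \<le> length ((hext k' ^^ Suc n) (map Some r))"
      using A' rA' by (intro length_hext_pow_mono[of A']) auto
    ultimately show ?thesis using c(3) by (auto simp del: funpow.simps(2))
  qed
  then have "\<not> mortal K x"
    unfolding mortal_def by (metis funpow.simps(2) hext_simps(1) o_apply)
  then have pr: "prolongable K (None, 0)" using Kx by (auto simp: prolongable_def)
  \<comment> \<open>The start letter alone need not be a full block, so the iterates are sequences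
    of blocks only from the first application on.\<close>
  have KSuc: "(hext K ^^ Suc n) [(None, 0)] = concat (map block ((hext k' ^^ Suc n) [None]))" for n
  proof -
    have "hext K [(None, 0)] = concat (map block (hext k' [None]))" by (simp add: K_def)
    moreover have "set (hext k' [None]) \<subseteq> A'" using A'(1) NA by simp
    ultimately show ?thesis using Kpow by (simp only: hext_pow_Suc_right)
  qed
  have img: "concat (map g' ((hext k' ^^ n) [None])) = y @ concat (map g ((hext k ^^ n) [c]))" for n
    using k'N[of n] by (auto simp: g'_def comp_def)
  have pS: "is_prefix_of_word (map e ((hext K ^^ Suc n) [(None, 0)])) \<alpha>" for n
    using pre[of "Suc n"] by (simp only: KSuc eb img)
  have p: "is_prefix_of_word (map e ((hext K ^^ n) [(None, 0)])) \<alpha>" for n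
  proof (cases n)
    case 0
    then show ?thesis using pS[of 0] Kx by (auto simp: is_prefix_of_word_def nth_Cons')
  qed (use pS in auto)
  show ?thesis
  proof (rule morphicI[OF _ _ _ pr p])
    show "finite B" using fin by (auto simp: B_def A'_def)
    show "(None, 0) \<in> B" using block[OF NA] NA unfolding B_def by (intro UN_I[of None]) auto
    show "\<forall>b\<in>B. set (K b) \<subseteq> B"
    proof
      fix x assume "x \<in> B"
      then obtain b i where x: "x = (b, i)" "b \<in> A'" by (auto simp: B_def block_def)
      have "set (block d) \<subseteq> B" if "d \<in> set (k' b)" for d
        using that A'(1) x(2) by (auto simp: B_def)
      then show "set (K x) \<subseteq> B" by (auto simp: K_def x(1))
    qed
  qed
qed

text \<open>The word \<open>True\<close>, \<open>False\<close>, \<open>False\<close>, ... is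
  generated by a prolongable morphism; mapping each of its letters to the block \<open>T\<close>
  gives the periodic part.\<close>

lemma morphic_if_ultimately_periodic:
  assumes T: "T \<noteq> []" and pre: "\<And>n. is_prefix_of_word (y @ concat (replicate n T)) \<alpha>"
  shows "morphic \<alpha>"
proof -
  let ?k = "\<lambda>b::bool. if b then [True, False] else [False]"
  have "(hext ?k ^^ n) [True] = True # replicate n False" for n
  proof (induction n)
    case (Suc n)
    have "hext ?k (replicate n False) = replicate n False" by (induction n) auto
    then show ?case using Suc by (simp)
  qed simp
  then have "concat (map (\<lambda>_. T) ((hext ?k ^^ n) [True])) = concat (replicate (Suc n) T)" for n
    by simp
  then show ?thesis using T pre
    by (intro morphic_if_prolongable[of UNIV ?k "\<lambda>_. T" True "[False]" y]) (auto simp del: replicate.simps)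
qed

lemma hext_pow_idem:
  assumes "hext h (hext h s) = hext h s"
  shows "(hext h ^^ Suc n) s = hext h s"
  using assms by (induction n) auto

text \<open>\<open>S\<close> and \<open>s\<close> stabilise after one application. If
  \<open>s\<close> is empty, \<open>c\<close> starts its own image and the stable image of
  \<open>S\<close> is a constant prefix \<open>y\<close>. Otherwise the iterates on \<open>c\<close>
  begin with more and more copies of \<open>hext h s\<close>, and \<alpha> is periodic after
  \<open>y\<close>.\<close>

lemma morphic_if_letter_recurs:
  fixes h :: "'a \<Rightarrow> 'a list" and g :: "'a \<Rightarrow> 't list"
  assumes fin: "finite A" and hA: "\<forall>b\<in>A. set (h b) \<subseteq> A \<and> h b \<noteq> [] \<and> g b \<noteq> []"
    and c: "c \<in> A" "h c = s @ c # r" "h c \<noteq> [c]"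
    and S: "hext h (hext h S) = hext h S" and s: "hext h (hext h s) = hext h s"
    and pre: "\<And>n. is_prefix_of_word (concat (map g ((hext h ^^ n) (S @ c # R)))) \<alpha>"
  shows "morphic \<alpha>"
proof -
  define y where "y = concat (map g (hext h S))"
  have y: "is_prefix_of_word (y @ concat (map g ((hext h ^^ Suc n) [c]))) \<alpha>" for n
  proof -
    have "(hext h ^^ Suc n) (S @ c # R) = hext h S @ (hext h ^^ Suc n) [c] @ (hext h ^^ Suc n) R"
      using hext_pow_append[of "Suc n" h S "c # R"] hext_pow_Cons[of "Suc n" h c R]
        hext_pow_idem[OF S, of n] by (simp del: funpow.simps)
    then have "is_prefix_of_word ((y @ concat (map g ((hext h ^^ Suc n) [c]))) @
        concat (map g ((hext h ^^ Suc n) R))) \<alpha>"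
      using pre[of "Suc n"] unfolding y_def by (simp del: funpow.simps)
    then show ?thesis by (rule is_prefix_of_word_appendD1)
  qed
  have step: "(hext h ^^ Suc n) [c] = (hext h ^^ n) s @ (hext h ^^ n) [c] @ (hext h ^^ n) r" for n
    using c(2) hext_pow_append[of n h s "c # r"] hext_pow_Cons[of n h c r]
    by (simp add: hext_pow_Suc_right del: funpow.simps)
  show ?thesis
  proof (cases "s = []")
    case True
    have "is_prefix_of_word ((y @ concat (map g ((hext h ^^ n) [c]))) @
        concat (map g ((hext h ^^ n) r))) \<alpha>" for n
      using y[of n] step[of n] True by (simp del: funpow.simps)
    then have "is_prefix_of_word (y @ concat (map g ((hext h ^^ n) [c]))) \<alpha>" for n
      by (rule is_prefix_of_word_appendD1)
    then show ?thesis using True c hA fin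
      by (intro morphic_if_prolongable[of A h g c r y]) auto
  next
    case False
    \<comment> \<open>The exponent exceeds the number of copies by one, since the innermost copy is
      \<open>s\<close> itself and not yet \<open>hext h s\<close>.\<close>
    have "\<exists>z. (hext h ^^ Suc n) [c] = concat (replicate n (hext h s)) @ z" for n
    proof (induction n)
      case (Suc n)
      then show ?case using step[of "Suc n"] hext_pow_idem[OF s, of n] by (auto simp del: funpow.simps)
    qed auto
    then have "\<exists>z. concat (map g ((hext h ^^ Suc n) [c])) =
        concat (replicate n (concat (map g (hext h s)))) @ z" for n
    proof -
      have "concat (map g (concat (replicate n x))) = concat (replicate n (concat (map g x)))" for x n
        by (induction n) auto
      then show ?thesis using \<open>\<exists>z. (hext h ^^ Suc n) [c] = concat (replicate n (hext h s)) @ z\<close>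
        by (metis concat_append map_append)
    qed
    then have "is_prefix_of_word (y @ concat (replicate n (concat (map g (hext h s))))) \<alpha>" for n
      using y[of n] by (metis append.assoc is_prefix_of_word_appendD1)
    moreover have "concat (map g (hext h s)) \<noteq> []"
    proof -
      obtain b s' where "s = b # s'" using False by (cases s) auto
      moreover then have "b \<in> A" using c hA by force
      moreover then obtain d t where "h b = d # t" "d \<in> A" using hA by (cases "h b") force+
      ultimately show ?thesis using hA by auto
    qed
    ultimately show ?thesis by (intro morphic_if_ultimately_periodic)
  qed
qed

section \<open>Bounded and growing letters\<close>

text \<open>The orbit is periodic from step \<open>i\<close> on with period \<open>p\<close>. Any
  positive multiple of \<open>p\<close> that is at least \<open>i\<close> serves as
  \<open>N\<close>, for instance \<open>p * Suc i\<close>.\<close>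

lemma funpow_finite_orbit_idem:
  fixes f :: "'a \<Rightarrow> 'a"
  assumes "finite A" "\<And>n. (f ^^ n) x \<in> A"
  obtains N where "N > 0" "(f ^^ (N + N)) x = (f ^^ N) x"
proof -
  have "\<not> inj (\<lambda>n. (f ^^ n) x)"
    using assms by (metis UNIV_I finite_subset image_subsetI infinite_UNIV_nat finite_imageD)
  then obtain i j where ij: "i < j" "(f ^^ i) x = (f ^^ j) x"
    unfolding inj_def by (metis nat_neq_iff)
  define p where "p = j - i"
  have p: "p > 0" "(f ^^ (p + i)) x = (f ^^ i) x" using ij by (auto simp: p_def)
  have per: "(f ^^ (p + (d + i))) x = (f ^^ (d + i)) x" for d
  proof -
    have "(f ^^ (p + (d + i))) x = (f ^^ d) ((f ^^ (p + i)) x)"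
      by (metis add.left_commute comp_apply funpow_add)
    then show ?thesis using p(2) by (simp add: funpow_add)
  qed
  have "(f ^^ (p * t + (d + i))) x = (f ^^ (d + i)) x" for t d
  proof (induction t)
    case (Suc t)
    then show ?case using per[of "p * t + d"] by (simp add: algebra_simps)
  qed simp
  from this[of "Suc i" "p * Suc i - i"] show ?thesis
  proof (intro that[of "p * Suc i"])
    have "i \<le> p * Suc i" using p(1) by (cases p) auto
    then show "(f ^^ (p * Suc i + p * Suc i)) x = (f ^^ (p * Suc i)) x"
      using \<open>(f ^^ (p * Suc i + (p * Suc i - i + i))) x = (f ^^ (p * Suc i - i + i)) x\<close> by simp
  qed (use p in simp)
qed

definition grow :: "('a \<Rightarrow> 'a list) \<Rightarrow> 'a \<Rightarrow> bool" where
  "grow h b \<longleftrightarrow> (\<forall>m. \<exists>n. m \<le> length ((hext h ^^ n) [b]))"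

lemma not_grow_bound:
  assumes "\<forall>b\<in>set x. \<not> grow h b"
  shows "\<exists>m. \<forall>n. length ((hext h ^^ n) x) \<le> m"
  using assms
proof (induction x)
  case (Cons b x)
  then obtain m where m: "\<forall>n. length ((hext h ^^ n) x) \<le> m" by auto
  obtain m' where m': "\<forall>n. length ((hext h ^^ n) [b]) < m'"
    using Cons.prems by (auto simp: grow_def not_le)
  show ?case using m m' by (intro exI[of _ "m' + m"])
    (metis add_le_mono hext_pow_Cons length_append less_imp_le_nat)
qed simp

lemma grow_hext_iff: "grow h b \<longleftrightarrow> (\<exists>c\<in>set (h b). grow h c)"
proof
  assume g: "grow h b"
  show "\<exists>c\<in>set (h b). grow h c"
  proof (rule ccontr)
    assume "\<not> (\<exists>c\<in>set (h b). grow h c)"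
    then obtain m where m: "\<forall>n. length ((hext h ^^ n) (h b)) \<le> m"
      using not_grow_bound[of "h b" h] by auto
    obtain n where n: "Suc (Suc m) \<le> length ((hext h ^^ n) [b])" using g by (auto simp: grow_def)
    then obtain n' where "n = Suc n'" by (cases n) auto
    then show False using n m[rule_format, of n'] by (simp add: hext_pow_Suc_right del: funpow.simps)
  qed
next
  assume "\<exists>c\<in>set (h b). grow h c"
  then obtain c s r where c: "grow h c" "h b = s @ c # r" by (meson split_list)
  show "grow h b" unfolding grow_def
  proof
    fix m
    obtain n where n: "m \<le> length ((hext h ^^ n) [c])" using c(1) by (auto simp: grow_def)
    have "(hext h ^^ Suc n) [b] = (hext h ^^ n) s @ (hext h ^^ n) [c] @ (hext h ^^ n) r"
      using c(2) hext_pow_append[of n h s "c # r"] hext_pow_Cons[of n h c r]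
      by (simp add: hext_pow_Suc_right del: funpow.simps)
    then have "m \<le> length ((hext h ^^ Suc n) [b])" using n by (simp del: funpow.simps)
    then show "\<exists>n. m \<le> length ((hext h ^^ n) [b])" by blast
  qed
qed

text \<open>As \<open>h\<close> is nonerasing, lengths never decrease, so the exponent
  \<open>n\<close> can be raised to the multiple \<open>N * n\<close>.\<close>

lemma grow_hpow:
  assumes hA: "\<forall>b\<in>A. set (h b) \<subseteq> A \<and> h b \<noteq> []" and b: "b \<in> A" and N: "N > 0"
    and g: "grow h b"
  shows "grow (hpow h N) b"
  unfolding grow_def
proof
  fix m
  obtain n where "m \<le> length ((hext h ^^ n) [b])" using g by (auto simp: grow_def)
  also have "\<dots> \<le> length ((hext h ^^ (N * n)) [b])"
    using hA b N by (intro length_hext_pow_mono) auto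
  finally show "\<exists>n. m \<le> length ((hext (hpow h N) ^^ n) [b])" by (auto simp: hext_hpow_pow)
qed

lemma hpow_nonerasing:
  assumes hA: "\<forall>b\<in>A. set (h b) \<subseteq> A \<and> h b \<noteq> []"
  shows "\<forall>b\<in>A. set (hpow h N b) \<subseteq> A \<and> hpow h N b \<noteq> []"
proof
  fix b assume b: "b \<in> A"
  have "length ((hext h ^^ 0) [b]) \<le> length ((hext h ^^ N) [b])"
    using hA b by (intro length_hext_pow_mono) auto
  then show "set (hpow h N b) \<subseteq> A \<and> hpow h N b \<noteq> []"
    using set_hext_pow_subset[of A h "[b]" N] hA b by (auto simp: hpow_def)
qed

text \<open>All bounded letters are iterated at once, as one point of a finite function space; the
  exponent found for this single orbit is common to all of them.\<close>

lemma bounded_letters_idem: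
  assumes fin: "finite A" and hA: "\<forall>b\<in>A. set (h b) \<subseteq> A"
  obtains N where "N > 0" "\<And>b. b \<in> A \<Longrightarrow> \<not> grow h b \<Longrightarrow> (hext h ^^ (N + N)) [b] = (hext h ^^ N) [b]"
proof -
  define D where "D = {b\<in>A. \<not> grow h b}"
  have "\<exists>m. \<forall>b\<in>D. \<forall>n. length ((hext h ^^ n) [b]) \<le> m"
  proof -
    have "\<forall>b\<in>D. \<exists>m. \<forall>n. length ((hext h ^^ n) [b]) \<le> m"
    proof
      fix b assume "b \<in> D"
      then show "\<exists>m. \<forall>n. length ((hext h ^^ n) [b]) \<le> m"
        using not_grow_bound[of "[b]" h] by (simp add: D_def)
    qed
    then obtain m where m: "\<forall>b\<in>D. \<forall>n. length ((hext h ^^ n) [b]) \<le> m b" by metis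
    have "finite D" using fin by (simp add: D_def)
    then have "\<forall>b\<in>D. m b \<le> Max (m ` D)" by auto
    then show ?thesis using m by (meson le_trans)
  qed
  then obtain m where m: "\<forall>b\<in>D. \<forall>n. length ((hext h ^^ n) [b]) \<le> m" by blast
  define W where "W = {x. set x \<subseteq> A \<and> length x \<le> m}"
  define X where "X = {\<phi>. \<forall>b. (b \<in> D \<longrightarrow> \<phi> b \<in> W) \<and> (b \<notin> D \<longrightarrow> \<phi> b = [])}"
  \<comment> \<open>Each bounded letter starts at itself; the empty word elsewhere keeps the orbit
    inside the finite set \<open>X\<close>.\<close>
  define \<iota> where "\<iota> = (\<lambda>b. if b \<in> D then [b] else [])"
  have "finite W" unfolding W_def using fin by (rule finite_lists_length_le)
  then have "finite X" unfolding X_def using fin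
    by (intro finite_set_of_finite_funs) (auto simp: D_def)
  moreover have pw: "((\<lambda>\<phi> b. hext h (\<phi> b)) ^^ n) \<iota> = (\<lambda>b. (hext h ^^ n) (\<iota> b))" for n
    by (induction n) auto
  moreover have "(\<lambda>b. (hext h ^^ n) (\<iota> b)) \<in> X" for n
    using m set_hext_pow_subset[OF hA, of "[_]" n] by (auto simp: X_def W_def \<iota>_def D_def)
  ultimately obtain N where N: "N > 0"
    "((\<lambda>\<phi> b. hext h (\<phi> b)) ^^ (N + N)) \<iota> = ((\<lambda>\<phi> b. hext h (\<phi> b)) ^^ N) \<iota>"
    using funpow_finite_orbit_idem[of X "\<lambda>\<phi> b. hext h (\<phi> b)" \<iota>] by metis
  show ?thesis
  proof (rule that[OF N(1)])
    fix b assume "b \<in> A" "\<not> grow h b"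
    then have "\<iota> b = [b]" by (simp add: \<iota>_def D_def)
    then show "(hext h ^^ (N + N)) [b] = (hext h ^^ N) [b]" using N(2) unfolding pw by metis
  qed
qed

lemma split_first_growing:
  assumes "\<exists>b\<in>set x. grow h b"
  shows "\<exists>s r c. x = s @ c # r \<and> grow h c \<and> (\<forall>b\<in>set s. \<not> grow h b)"
  using split_list_first_prop[OF assms] by blast

text \<open>The image of a growing letter contains a growing letter, so the first growing letter can
  be followed by \<open>F\<close> through all iterates, with only bounded letters before it. In the
  finite alphabet it enters a cycle, and there a power of \<open>h\<close> reproduces it behind a
  bounded prefix \<open>s\<close>, as \<open>morphic_if_letter_recurs\<close> demands.\<close>

lemma morphic_if_bounded_letters_idem:
  fixes h :: "'a \<Rightarrow> 'a list" and g :: "'a \<Rightarrow> 't list"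
  assumes fin: "finite A" and hA: "\<forall>b\<in>A. set (h b) \<subseteq> A \<and> h b \<noteq> [] \<and> g b \<noteq> []"
    and w: "set w \<subseteq> A" "\<exists>b\<in>set w. grow h b"
    and idem: "\<And>b. b \<in> A \<Longrightarrow> \<not> grow h b \<Longrightarrow> hext h (h b) = h b"
    and pre: "\<And>n. is_prefix_of_word (concat (map g ((hext h ^^ n) w))) \<alpha>"
  shows "morphic \<alpha>"
proof -
  define bw where "bw = (\<lambda>s. set s \<subseteq> A \<and> (\<forall>b\<in>set s. \<not> grow h b))"
  have bw_app: "bw (x @ y) \<longleftrightarrow> bw x \<and> bw y" for x y by (auto simp: bw_def)
  have bw_h: "bw (hext h s)" if "bw s" for s
    unfolding bw_def
  proof
    show "set (hext h s) \<subseteq> A" using that hA by (auto simp: bw_def set_hext)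
    show "\<forall>b\<in>set (hext h s). \<not> grow h b"
      using that unfolding bw_def set_hext by (metis UN_E grow_hext_iff)
  qed
  have bw_idem: "hext h (hext h s) = hext h s" if "bw s" for s
    using that by (induction s) (auto simp: bw_def idem)
  define F where "F = (\<lambda>c. SOME d. \<exists>s r. h c = s @ d # r \<and> grow h d \<and> bw s)"
  have F: "\<exists>s r. h c = s @ F c # r \<and> grow h (F c) \<and> bw s" if "c \<in> A" "grow h c" for c
  proof -
    have "\<exists>b\<in>set (h c). grow h b" using that(2) grow_hext_iff[of h c] by blast
    then obtain s r d where s: "h c = s @ d # r \<and> grow h d \<and> (\<forall>b\<in>set s. \<not> grow h b)"
      using split_first_growing[of "h c" h] by blast
    moreover have "set (h c) \<subseteq> A" using hA that(1) by blast
    ultimately have "\<exists>d s r. h c = s @ d # r \<and> grow h d \<and> bw s"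
      unfolding bw_def by (intro exI[of _ d] exI[of _ s] exI[of _ r]) auto
    then show ?thesis unfolding F_def by (rule someI_ex)
  qed
  have Fn: "\<exists>s r. (hext h ^^ n) x = s @ (F ^^ n) c # r \<and> bw s \<and> (F ^^ n) c \<in> A \<and> grow h ((F ^^ n) c)"
    if "x = S @ c # R" "bw S" "c \<in> A" "grow h c" for x S c R n
  proof (induction n)
    case (Suc n)
    then obtain s r where s: "(hext h ^^ n) x = s @ (F ^^ n) c # r" "bw s"
      "(F ^^ n) c \<in> A" "grow h ((F ^^ n) c)" by blast
    obtain s' r' where s': "h ((F ^^ n) c) = s' @ F ((F ^^ n) c) # r'"
      "grow h (F ((F ^^ n) c))" "bw s'" using F[OF s(3,4)] by blast
    have "F ((F ^^ n) c) \<in> A"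
    proof -
      have "set (h ((F ^^ n) c)) \<subseteq> A" using hA s(3) by blast
      then show ?thesis unfolding s'(1) by simp
    qed
    then show ?case using s s' bw_h[OF s(2)]
      by (intro exI[of _ "hext h s @ s'"] exI[of _ "r' @ hext h r"]) (simp add: bw_app)
  qed (use that in auto)
  obtain S R c0 where S: "w = S @ c0 # R" "bw S" "grow h c0" "c0 \<in> A"
    using split_first_growing[OF w(2)] w(1) by (auto simp: bw_def)
  have "(F ^^ n) c0 \<in> A" for n using Fn[OF S(1,2,4,3)] by blast
  then obtain p where p: "p > 0" "(F ^^ (p + p)) c0 = (F ^^ p) c0"
    using funpow_finite_orbit_idem[OF fin, of F c0] by blast
  define c where "c = (F ^^ p) c0"
  obtain S' R' where S': "(hext h ^^ p) w = S' @ c # R'" "bw S'" "c \<in> A" "grow h c"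
    using Fn[OF S(1,2,4,3), of p] by (auto simp: c_def)
  have Fc: "(F ^^ p) c = c" using p(2) by (simp add: c_def funpow_add)
  obtain s r where s: "hpow h p c = s @ c # r" "bw s"
    using Fn[of "[c]" "[]" c "[]" p] S' Fc by (auto simp: hpow_def bw_def)
  let ?k = "hpow h p"
  have gk: "grow ?k c" using hA S'(3,4) p(1) by (intro grow_hpow[of A]) auto
  have kidem: "hext ?k (hext ?k t) = hext ?k t" if "bw t" for t
  proof -
    obtain p' where p': "p = Suc p'" using p(1) by (cases p) auto
    have "(hext h ^^ (p + p)) t = (hext h ^^ p) t"
      using hext_pow_idem[OF bw_idem[OF that]] unfolding p' by (metis add_Suc)
    then show ?thesis by (simp add: hext_hpow hext_pow_add)
  qed
  show ?thesis
  proof (rule morphic_if_letter_recurs[where h = ?k and g = g and s = s and r = r and S = S' and R = R',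
        OF fin _ S'(3)])
    show "\<forall>b\<in>A. set (?k b) \<subseteq> A \<and> ?k b \<noteq> [] \<and> g b \<noteq> []"
      using hpow_nonerasing[of A h p] hA by auto
    show "?k c \<noteq> [c]"
    proof
      assume "?k c = [c]"
      then have "(hext ?k ^^ n) [c] = [c]" for n by (induction n) auto
      then have "length ((hext ?k ^^ n) [c]) = 1" for n by simp
      moreover obtain n where "2 \<le> length ((hext ?k ^^ n) [c])" using gk unfolding grow_def by blast
      ultimately show False by simp
    qed
    \<comment> \<open>The first \<open>p\<close> applications lead from \<open>w\<close> to
      \<open>S' @ c # R'\<close>.\<close>
    show "is_prefix_of_word (concat (map g ((hext ?k ^^ n) (S' @ c # R')))) \<alpha>" for n
      using pre[of "p * n + p"] unfolding S'(1)[symmetric] hext_hpow_pow by (simp add: hext_pow_add)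
  qed (use kidem S' s in simp_all)
qed

text \<open>Passing to the power \<open>N\<close> makes the bounded letters idempotent. Growing
  letters stay growing, so the power has no bounded letters beyond those covered by
  \<open>N\<close>.\<close>

lemma morphic_if_nonerasing:
  fixes h :: "'a \<Rightarrow> 'a list" and g :: "'a \<Rightarrow> 't list"
  assumes fin: "finite A" and hA: "\<forall>b\<in>A. set (h b) \<subseteq> A \<and> h b \<noteq> [] \<and> g b \<noteq> []"
    and w: "set w \<subseteq> A" "\<And>m. \<exists>n. m \<le> length ((hext h ^^ n) w)"
    and pre: "\<And>n. is_prefix_of_word (concat (map g ((hext h ^^ n) w))) \<alpha>"
  shows "morphic \<alpha>"
proof -
  obtain N where N: "N > 0"
    "\<And>b. b \<in> A \<Longrightarrow> \<not> grow h b \<Longrightarrow> (hext h ^^ (N + N)) [b] = (hext h ^^ N) [b]"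
    using bounded_letters_idem[OF fin, of h] hA by blast
  have gr: "grow (hpow h N) b" if "b \<in> A" "grow h b" for b
    using that hA N(1) by (intro grow_hpow[of A]) auto
  have "\<exists>b\<in>set w. grow h b"
  proof (rule ccontr)
    assume "\<not> (\<exists>b\<in>set w. grow h b)"
    then obtain m where "\<forall>n. length ((hext h ^^ n) w) \<le> m" using not_grow_bound[of w h] by blast
    then show False using w(2)[of "Suc m"] by (meson not_less_eq_eq)
  qed
  show ?thesis
  proof (rule morphic_if_bounded_letters_idem[OF fin _ w(1)])
    show "\<forall>b\<in>A. set (hpow h N b) \<subseteq> A \<and> hpow h N b \<noteq> [] \<and> g b \<noteq> []"
      using hpow_nonerasing[of A h N] hA by auto
    show "\<exists>b\<in>set w. grow (hpow h N) b" using \<open>\<exists>b\<in>set w. grow h b\<close> gr w(1) by blast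
    show "hext (hpow h N) (hpow h N b) = hpow h N b" if "b \<in> A" "\<not> grow (hpow h N) b" for b
      using N(2)[of b] that gr by (auto simp: hext_hpow hpow_def hext_pow_add)
    show "is_prefix_of_word (concat (map g ((hext (hpow h N) ^^ n) w))) \<alpha>" for n
      using pre by (simp add: hext_hpow_pow)
  qed
qed

lemma set_hext_pow: "set ((hext h ^^ n) x) = (\<Union>c\<in>set x. set ((hext h ^^ n) [c]))"
proof (induction x)
  case (Cons d x)
  then show ?case using hext_pow_Cons[of n h d x] by simp
qed simp

lemma length_concat_map_le:
  assumes "\<forall>b\<in>set x. length (g b) \<le> m"
  shows "length (concat (map g x)) \<le> m * length x"
  using assms by (induction x) auto

text \<open>\<open>(F ^^ n) B0\<close> consists of the letters whose nth iterate contains a letter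
  with nonempty image under \<open>g\<close>. At an idempotent exponent \<open>N\<close> this set
  \<open>B\<close> is stable: its letters are those with nonempty \<open>g'\<close>, and also those
  whose image under \<open>hpow h N\<close> meets \<open>B\<close>. Deleting all other letters
  preserves the images and leaves a nonerasing morphism.\<close>

lemma morphic_if_prefixes_iterated:
  fixes h :: "'a \<Rightarrow> 'a list" and g :: "'a \<Rightarrow> 't list"
  assumes fin: "finite A" and hA: "\<forall>b\<in>A. set (h b) \<subseteq> A" and w: "set w \<subseteq> A"
    and pre: "\<And>n. is_prefix_of_word (concat (map g ((hext h ^^ n) w))) \<alpha>"
    and len: "\<And>n. n \<le> length (concat (map g ((hext h ^^ n) w)))"
  shows "morphic \<alpha>"
proof -
  define F where "F = (\<lambda>B. {b\<in>A. set (h b) \<inter> B \<noteq> {}})"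
  define B0 where "B0 = {b\<in>A. g b \<noteq> []}"
  have Fn: "(F ^^ n) B = {b\<in>A. set ((hext h ^^ n) [b]) \<inter> B \<noteq> {}}" if "B \<subseteq> A" for n B
  proof (induction n)
    case (Suc n)
    have "set ((hext h ^^ Suc n) [b]) = (\<Union>c\<in>set (h b). set ((hext h ^^ n) [c]))" for b
      using set_hext_pow[of n h "h b"] by (simp add: hext_pow_Suc_right del: funpow.simps)
    moreover have "(F ^^ Suc n) B = F {b\<in>A. set ((hext h ^^ n) [b]) \<inter> B \<noteq> {}}"
      using Suc by simp
    moreover have "F {b\<in>A. set ((hext h ^^ n) [b]) \<inter> B \<noteq> {}} =
        {b\<in>A. (\<Union>c\<in>set (h b). set ((hext h ^^ n) [c])) \<inter> B \<noteq> {}}"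
      using hA unfolding F_def by blast
    ultimately show ?case by (simp only:)
  qed (use that in auto)
  have "(F ^^ n) B0 \<in> Pow A" for n using Fn[of B0 n] by (auto simp: B0_def)
  then obtain N where N: "N > 0" "(F ^^ (N + N)) B0 = (F ^^ N) B0"
    using funpow_finite_orbit_idem[of "Pow A" F B0] fin by blast
  define B where "B = (F ^^ N) B0"
  define g' where "g' = (\<lambda>b. concat (map g (hpow h N b)))"
  have hN: "\<forall>b\<in>A. set (hpow h N b) \<subseteq> A"
    using set_hext_pow_subset[OF hA] by (simp add: hpow_def)
  have BA: "B \<subseteq> A" using Fn[of B0 N] by (auto simp: B_def B0_def)
  have Bg: "b \<in> B \<longleftrightarrow> g' b \<noteq> []" if "b \<in> A" for b
  proof -
    have "b \<in> B \<longleftrightarrow> set (hpow h N b) \<inter> B0 \<noteq> {}"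
      using Fn[of B0 N] that by (auto simp: B_def B0_def hpow_def)
    also have "\<dots> \<longleftrightarrow> g' b \<noteq> []" using hN that by (fastforce simp: g'_def B0_def)
    finally show ?thesis .
  qed
  have "(F ^^ N) B = B" using N(2) by (simp add: B_def funpow_add)
  then have Bh: "b \<in> B \<longleftrightarrow> set (hpow h N b) \<inter> B \<noteq> {}" if "b \<in> A" for b
    using Fn[OF BA, of N] that by (auto simp: hpow_def)
  define k where "k = (\<lambda>b. filter (\<lambda>c. c \<in> B) (hpow h N b))"
  have fil: "filter (\<lambda>c. c \<in> B) (hext (hpow h N) x) = hext k (filter (\<lambda>c. c \<in> B) x)"
    if "set x \<subseteq> A" for x
    using that
  proof (induction x)
    case (Cons b x)
    have "filter (\<lambda>c. c \<in> B) (hpow h N b) = []" if "b \<notin> B"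
      using Bh[of b] that Cons.prems by (auto simp: filter_empty_conv)
    then show ?case using Cons by (auto simp: k_def)
  qed simp
  let ?w = "filter (\<lambda>c. c \<in> B) w"
  have kn: "(hext k ^^ n) ?w = filter (\<lambda>c. c \<in> B) ((hext (hpow h N) ^^ n) w)" for n
    using set_hext_pow_subset[OF hN w] by (induction n) (auto simp: fil)
  have g'f: "concat (map g' (filter (\<lambda>c. c \<in> B) x)) = concat (map g' x)" if "set x \<subseteq> A" for x
    using that Bg by (induction x) auto
  have g'h: "concat (map g' x) = concat (map g ((hext h ^^ N) x))" for x
  proof -
    have "concat (map g' x) = concat (map g (hext (hpow h N) x))"
      by (induction x) (auto simp: g'_def)
    then show ?thesis by (simp add: hext_hpow)
  qed
  have img: "concat (map g' ((hext k ^^ n) ?w)) = concat (map g ((hext h ^^ (N + N * n)) w))" for n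
    unfolding kn g'f[OF set_hext_pow_subset[OF hN w]]
    by (simp add: g'h hext_hpow_pow hext_pow_add)
  have kB: "\<forall>b\<in>B. set (k b) \<subseteq> B \<and> k b \<noteq> [] \<and> g' b \<noteq> []"
    using Bh Bg BA by (fastforce simp: k_def filter_empty_conv)
  show ?thesis
  proof (rule morphic_if_nonerasing[OF _ kB])
    show "finite B" using fin BA by (rule rev_finite_subset)
    show "set ?w \<subseteq> B" by auto
    then have sub: "set ((hext k ^^ n) ?w) \<subseteq> B" for n
      using kB by (intro set_hext_pow_subset) auto
    \<comment> \<open>Letters have images of length at most \<open>M\<close>, so unbounded images
      force unbounded iterates. Inserting 1 keeps \<open>M\<close> positive, so that it can be
      cancelled.\<close>
    define M where "M = Max (insert 1 ((length \<circ> g') ` B))"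
    have "\<forall>b\<in>B. length (g' b) \<le> M" "M > 0"
      using \<open>finite B\<close> unfolding M_def by (auto intro: Max_ge simp: Max_gr_iff)
    then have M: "length (concat (map g' ((hext k ^^ n) ?w))) \<le> M * length ((hext k ^^ n) ?w)" for n
      using sub[of n] by (intro length_concat_map_le) auto
    fix m
    have "M * m \<le> N + N * (M * m)" using N(1) by (simp add: trans_le_add2)
    also have "\<dots> \<le> M * length ((hext k ^^ (M * m)) ?w)"
      using le_trans[OF len M[of "M * m", unfolded img]] .
    finally show "\<exists>n. m \<le> length ((hext k ^^ n) ?w)" using \<open>M > 0\<close> by auto
  qed (use pre img in auto)
qed

section \<open>Derivations relative to a stack\<close>

text \<open>\<open>der P xs \<delta> ys\<close>: if all nonterminals of xs carry the stack \<open>\<delta> @ \<gamma>\<close>, then xs derives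
  ys with all nonterminals of ys carrying \<open>\<gamma>\<close>, without looking at \<open>\<gamma>\<close>.\<close>

inductive der :: "('n,'t,'i) prod set \<Rightarrow> ('n,'t) sym list \<Rightarrow> 'i list \<Rightarrow> ('n,'t) sym list \<Rightarrow> bool"
  for P where
  nil: "der P [] \<delta> []"
| tm: "der P xs \<delta> ys \<Longrightarrow> der P (Tm a # xs) \<delta> (Tm a # ys)"
| stop: "der P xs [] ys \<Longrightarrow> der P (NT A # xs) [] (NT A # ys)"
| copy: "Copy A \<alpha> \<in> P \<Longrightarrow> der P \<alpha> \<delta> y \<Longrightarrow> der P xs \<delta> ys \<Longrightarrow> der P (NT A # xs) \<delta> (y @ ys)"
| push: "Push A B f \<in> P \<Longrightarrow> der P [NT B] (f # \<delta>) y \<Longrightarrow> der P xs \<delta> ys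
    \<Longrightarrow> der P (NT A # xs) \<delta> (y @ ys)"
| pop: "Pop A f \<alpha> \<in> P \<Longrightarrow> der P \<alpha> \<delta> y \<Longrightarrow> der P xs (f # \<delta>) ys
    \<Longrightarrow> der P (NT A # xs) (f # \<delta>) (y @ ys)"

inductive_cases der_NilE: "der P [] \<delta> ys"
inductive_cases der_TmE: "der P (Tm a # xs) \<delta> ys"

lemma der_append: "der P xs \<delta> ys \<Longrightarrow> der P xs' \<delta> ys' \<Longrightarrow> der P (xs @ xs') \<delta> (ys @ ys')"
proof (induction rule: der.induct)
  case (push A B f \<delta> y xs ys)
  then show ?case using der.push[of A B f P \<delta> y "xs @ xs'" "ys @ ys'"] by simp
next
  case (copy A \<alpha> \<delta> y xs ys)
  then show ?case using der.copy[of A \<alpha> P \<delta> y "xs @ xs'" "ys @ ys'"] by simp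
next
  case (pop A f \<alpha> \<delta> y xs ys)
  then show ?case using der.pop[of A f \<alpha> P \<delta> y "xs @ xs'" "ys @ ys'"] by simp
qed (auto intro: der.tm der.stop)

lemma der_appendD:
  assumes "der P xs \<delta> zs" "xs = x1 @ x2"
  shows "\<exists>y1 y2. zs = y1 @ y2 \<and> der P x1 \<delta> y1 \<and> der P x2 \<delta> y2"
  using assms
proof (induction arbitrary: x1 rule: der.induct)
  case (nil \<delta>)
  then show ?case using der.nil by fastforce
next
  case (tm xs \<delta> ys a)
  show ?case
  proof (cases x1)
    case Nil
    then show ?thesis using tm der.nil[of P \<delta>] der.tm[OF tm(1), of a] by auto
  next
    case (Cons b x)
    then obtain y1 y2 where "ys = y1 @ y2" "der P x \<delta> y1" "der P x2 \<delta> y2" using tm by auto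
    then show ?thesis using Cons tm(3) der.tm[of P x \<delta> y1 a]
      by (intro exI[of _ "Tm a # y1"] exI[of _ y2]) auto
  qed
next
  case (stop xs ys A)
  show ?case
  proof (cases x1)
    case Nil
    then show ?thesis using stop der.nil[of P "[]"] der.stop[OF stop(1), of A] by auto
  next
    case (Cons b x)
    then obtain y1 y2 where "ys = y1 @ y2" "der P x [] y1" "der P x2 [] y2" using stop by auto
    then show ?thesis using Cons stop(3) der.stop[of P x y1 A]
      by (intro exI[of _ "NT A # y1"] exI[of _ y2]) auto
  qed
next
  case (copy A \<alpha> \<delta> y xs ys)
  show ?case
  proof (cases x1)
    case Nil
    then show ?thesis using copy.prems der.nil[of P \<delta>] der.copy[OF copy.hyps] by auto
  next
    case (Cons b x)
    then obtain y1 y2 where "ys = y1 @ y2" "der P x \<delta> y1" "der P x2 \<delta> y2" using copy by auto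
    then show ?thesis using Cons copy.prems der.copy[OF copy.hyps(1,2), of x y1]
      by (intro exI[of _ "y @ y1"] exI[of _ y2]) auto
  qed
next
  case (push A B f \<delta> y xs ys)
  show ?case
  proof (cases x1)
    case Nil
    then show ?thesis using push.prems der.nil[of P \<delta>] der.push[OF push.hyps] by auto
  next
    case (Cons b x)
    then obtain y1 y2 where "ys = y1 @ y2" "der P x \<delta> y1" "der P x2 \<delta> y2" using push by auto
    then show ?thesis using Cons push.prems der.push[OF push.hyps(1,2), of x y1]
      by (intro exI[of _ "y @ y1"] exI[of _ y2]) auto
  qed
next
  case (pop A f \<alpha> \<delta> y xs ys)
  show ?case
  proof (cases x1)
    case Nil
    then show ?thesis using pop.prems der.nil[of P "f # \<delta>"] der.pop[OF pop.hyps] by auto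
  next
    case (Cons b x)
    then obtain y1 y2 where "ys = y1 @ y2" "der P x (f # \<delta>) y1" "der P x2 (f # \<delta>) y2" using pop by auto
    then show ?thesis using Cons pop.prems der.pop[OF pop.hyps(1,2), of x y1]
      by (intro exI[of _ "y @ y1"] exI[of _ y2]) auto
  qed
qed

lemma der_ConsD: "der P (X # xs) \<delta> zs \<Longrightarrow> \<exists>y1 y2. zs = y1 @ y2 \<and> der P [X] \<delta> y1 \<and> der P xs \<delta> y2"
  by (rule der_appendD) simp_all

lemma der_ConsI: "der P [X] \<delta> y1 \<Longrightarrow> der P xs \<delta> y2 \<Longrightarrow> der P (X # xs) \<delta> (y1 @ y2)"
  by (drule (1) der_append) simp

lemma der_refl: "der P xs [] xs"
proof (induction xs)
  case (Cons X xs)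
  then show ?case by (cases X) (auto intro: der.tm der.stop)
qed (rule der.nil)

lemma der_singletonI:
  "Copy A \<alpha> \<in> P \<Longrightarrow> der P \<alpha> \<delta> y \<Longrightarrow> der P [NT A] \<delta> y"
  "Push A B f \<in> P \<Longrightarrow> der P [NT B] (f # \<delta>) y \<Longrightarrow> der P [NT A] \<delta> y"
  "Pop A f \<alpha> \<in> P \<Longrightarrow> der P \<alpha> \<delta> y \<Longrightarrow> der P [NT A] (f # \<delta>) y"
  by (drule (1) der.copy[OF _ _ der.nil] der.push[OF _ _ der.nil] der.pop[OF _ _ der.nil], simp)+

lemma der_Tm_singleton: "der P [Tm a] \<delta> [Tm a]"
  by (intro der.tm der.nil)

lemma der_Tm_singletonD: "der P [Tm a] \<delta> ys \<Longrightarrow> ys = [Tm a]"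
  by (auto elim!: der_NilE der_TmE)

lemma der_comp: "der P xs \<delta> ys \<Longrightarrow> der P ys \<gamma> zs \<Longrightarrow> der P xs (\<delta> @ \<gamma>) zs"
proof (induction arbitrary: zs rule: der.induct)
  case (nil \<delta>)
  then show ?case by (auto elim!: der_NilE intro: der.nil)
next
  case (tm xs \<delta> ys a)
  from der_ConsD[OF tm.prems] obtain y where "zs = Tm a # y" "der P ys \<gamma> y"
    using der_Tm_singletonD by fastforce
  then show ?case using tm by (auto intro: der.tm)
next
  case (stop xs ys A)
  from der_ConsD[OF stop.prems] obtain y1 y2 where "zs = y1 @ y2" "der P [NT A] \<gamma> y1" "der P ys \<gamma> y2"
    by blast
  then show ?case using der_ConsI[of P "NT A" \<gamma> y1 xs y2] stop.IH[of y2] by simp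
next
  case (copy A \<alpha> \<delta> y xs ys)
  from der_appendD[OF copy.prems refl] obtain y1 y2
    where z: "zs = y1 @ y2" "der P y \<gamma> y1" "der P ys \<gamma> y2" by blast
  show ?case using der.copy[OF copy.hyps(1) copy.IH(1)[OF z(2)] copy.IH(2)[OF z(3)]] z(1) by simp
next
  case (push A B f \<delta> y xs ys)
  from der_appendD[OF push.prems refl] obtain y1 y2
    where z: "zs = y1 @ y2" "der P y \<gamma> y1" "der P ys \<gamma> y2" by blast
  show ?case using der.push[OF push.hyps(1) push.IH(1)[OF z(2), unfolded append_Cons] push.IH(2)[OF z(3)]] z(1) by simp
next
  case (pop A f \<alpha> \<delta> y xs ys)
  from der_appendD[OF pop.prems refl] obtain y1 y2
    where z: "zs = y1 @ y2" "der P y \<gamma> y1" "der P ys \<gamma> y2" by blast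
  show ?case using der.pop[OF pop.hyps(1) pop.IH(1)[OF z(2)] pop.IH(2)[OF z(3), unfolded append_Cons]] z(1) by simp
qed

text \<open>Every path is cut at a moment when \<delta> is used up; \<open>ys\<close> lists the
  symbols reached there, together with the terminals produced earlier.\<close>

lemma der_decomp:
  assumes "der P xs (\<delta> @ \<gamma>) zs"
  shows "\<exists>ys. der P xs \<delta> ys \<and> der P ys \<gamma> zs"
proof -
  have "\<exists>ys. der P xs \<delta> ys \<and> der P ys \<gamma> zs" if "der P xs \<eta> zs" "\<eta> = \<delta> @ \<gamma>" for \<eta>
    using that
  proof (induction arbitrary: \<delta> rule: der.induct)
    case (nil \<eta>)
    then show ?case using der.nil by blast
  next
    case (tm xs \<eta> ys a)
    then obtain ys' where "der P xs \<delta> ys'" "der P ys' \<gamma> ys" by blast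
    then have "der P (Tm a # xs) \<delta> (Tm a # ys')" "der P (Tm a # ys') \<gamma> (Tm a # ys)"
      by (auto intro: der.tm)
    then show ?case by blast
  next
    case (stop xs ys A)
    then have "\<delta> = []" "\<gamma> = []" by auto
    then show ?case using der.stop[OF stop.hyps] der_refl[of P "NT A # xs"] by blast
  next
    case (copy A \<alpha> \<eta> y xs ys)
    obtain y' ys' where "der P \<alpha> \<delta> y'" "der P y' \<gamma> y" "der P xs \<delta> ys'" "der P ys' \<gamma> ys"
      using copy.IH[OF copy.prems] by blast
    then have "der P (NT A # xs) \<delta> (y' @ ys')" "der P (y' @ ys') \<gamma> (y @ ys)"
      by (auto intro: der.copy[OF copy.hyps(1)] der_append)
    then show ?case by blast
  next
    case (push A B f \<eta> y xs ys)
    obtain y' ys' where "der P [NT B] (f # \<delta>) y'" "der P y' \<gamma> y" "der P xs \<delta> ys'" "der P ys' \<gamma> ys"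
      using push.IH(1)[of "f # \<delta>"] push.IH(2)[of \<delta>] push.prems by auto
    then have "der P (NT A # xs) \<delta> (y' @ ys')" "der P (y' @ ys') \<gamma> (y @ ys)"
      by (auto intro: der.push[OF push.hyps(1)] der_append)
    then show ?case by blast
  next
    case (pop A f \<alpha> \<eta> y xs ys)
    show ?case
    proof (cases \<delta>)
      case Nil
      then show ?thesis using pop.prems der.pop[OF pop.hyps] der_refl[of P "NT A # xs"] by auto
    next
      case (Cons f' \<delta>')
      then have *: "f' = f" "\<eta> = \<delta>' @ \<gamma>" "\<delta> = f # \<delta>'" using pop.prems by auto
      obtain y' ys' where "der P \<alpha> \<delta>' y'" "der P y' \<gamma> y" "der P xs (f # \<delta>') ys'" "der P ys' \<gamma> ys"
        using pop.IH(1)[OF *(2)] pop.IH(2)[OF pop.prems] unfolding *(3) by auto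
      then have "der P (NT A # xs) (f # \<delta>') (y' @ ys')" "der P (y' @ ys') \<gamma> (y @ ys)"
        by (auto intro: der.pop[OF pop.hyps(1)] der_append)
      then show ?thesis unfolding *(3) by blast
    qed
  qed
  then show ?thesis using assms by blast
qed

section \<open>Relative derivations and derivation steps\<close>

lemma istep_context: "istep P s t \<Longrightarrow> istep P (p @ s @ q) (p @ t @ q)"
proof (induction rule: istep.induct)
  case (copy A \<alpha> u \<gamma> w)
  then show ?case using istep.copy[of A \<alpha> P "p @ u" \<gamma> "w @ q"] by simp
next
  case (push A B f u \<gamma> w)
  then show ?case using istep.push[of A B f P "p @ u" \<gamma> "w @ q"] by simp
next
  case (pop A f \<alpha> u \<gamma> w)
  then show ?case using istep.pop[of A f \<alpha> P "p @ u" \<gamma> "w @ q"] by simp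
qed

lemma isteps_context: "(istep P)\<^sup>*\<^sup>* s t \<Longrightarrow> (istep P)\<^sup>*\<^sup>* (p @ s @ q) (p @ t @ q)"
proof (induction rule: rtranclp_induct)
  case (step t t')
  then show ?case using istep_context[OF step(2), of p q] by (meson rtranclp.rtrancl_into_rtrancl)
qed simp

lemma isteps_append:
  assumes "(istep P)\<^sup>*\<^sup>* s t" "(istep P)\<^sup>*\<^sup>* s' t'"
  shows "(istep P)\<^sup>*\<^sup>* (s @ s') (t @ t')"
proof (rule rtranclp_trans)
  show "(istep P)\<^sup>*\<^sup>* (s @ s') (t @ s')" using isteps_context[OF assms(1), of "[]" s'] by simp
  show "(istep P)\<^sup>*\<^sup>* (t @ s') (t @ t')" using isteps_context[OF assms(2), of t "[]"] by simp
qed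

lemma der_isteps: "der P xs \<delta> ys \<Longrightarrow> (istep P)\<^sup>*\<^sup>* (map (inst \<delta>) xs) (map (inst []) ys)"
proof (induction rule: der.induct)
  case (tm xs \<delta> ys a)
  then show ?case using isteps_append[of P "[Ter a]" "[Ter a]"] by simp
next
  case (stop xs ys A)
  then show ?case using isteps_append[of P "[Var A []]" "[Var A []]"] by simp
next
  case (copy A \<alpha> \<delta> y xs ys)
  have "istep P [Var A \<delta>] (map (inst \<delta>) \<alpha>)" using istep.copy[OF copy(1), of "[]" \<delta> "[]"] by simp
  then have "(istep P)\<^sup>*\<^sup>* [Var A \<delta>] (map (inst []) y)" using copy.IH(1) by simp
  from isteps_append[OF this copy.IH(2)] show ?case by simp
next
  case (push A B f \<delta> y xs ys)
  have "istep P [Var A \<delta>] [Var B (f # \<delta>)]" using istep.push[OF push(1), of "[]" \<delta> "[]"] by simp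
  then have "(istep P)\<^sup>*\<^sup>* [Var A \<delta>] (map (inst []) y)" using push.IH(1) by simp
  from isteps_append[OF this push.IH(2)] show ?case by simp
next
  case (pop A f \<alpha> \<delta> y xs ys)
  have "istep P [Var A (f # \<delta>)] (map (inst \<delta>) \<alpha>)" using istep.pop[OF pop(1), of "[]" \<delta> "[]"] by simp
  then have "(istep P)\<^sup>*\<^sup>* [Var A (f # \<delta>)] (map (inst []) y)" using pop.IH(1) by simp
  from isteps_append[OF this pop.IH(2)] show ?case by simp
qed simp

text \<open>A sentential form is split into independent derivations of its items. Unlike
  \<open>der\<close>, this allows different stacks side by side and so can be followed backwards
  along single steps.\<close>

fun ider :: "('n,'t,'i) prod set \<Rightarrow> ('n,'t,'i) item list \<Rightarrow> 't list \<Rightarrow> bool" where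
  "ider P [] w \<longleftrightarrow> w = []"
| "ider P (Ter a # s) w \<longleftrightarrow> (\<exists>w'. w = a # w' \<and> ider P s w')"
| "ider P (Var A \<gamma> # s) w \<longleftrightarrow>
     (\<exists>w1 w2. w = w1 @ w2 \<and> der P [NT A] \<gamma> (map Tm w1) \<and> ider P s w2)"

lemma ider_append: "ider P (s @ t) w \<longleftrightarrow> (\<exists>w1 w2. w = w1 @ w2 \<and> ider P s w1 \<and> ider P t w2)"
proof (induction s arbitrary: w)
  case (Cons i s)
  show ?case
  proof (cases i)
    case (Var A \<gamma>)
    show ?thesis unfolding Var append_Cons ider.simps Cons.IH by (metis append.assoc)
  next
    case (Ter a)
    show ?thesis unfolding Ter append_Cons ider.simps Cons.IH by (metis append_Cons)
  qed
qed simp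

lemma ider_inst: "ider P (map (inst \<gamma>) xs) w \<Longrightarrow> der P xs \<gamma> (map Tm w)"
proof (induction xs arbitrary: w)
  case (Cons X xs)
  show ?case
  proof (cases X)
    case (NT A)
    then obtain w1 w2 where "w = w1 @ w2" "der P [NT A] \<gamma> (map Tm w1)" "der P xs \<gamma> (map Tm w2)"
      using Cons by auto
    then show ?thesis using der_ConsI[of P "NT A" \<gamma> "map Tm w1" xs "map Tm w2"] NT by simp
  next
    case (Tm a)
    then obtain w' where "w = a # w'" "ider P (map (inst \<gamma>) xs) w'" using Cons.prems by auto
    then show ?thesis using der.tm[OF Cons.IH[of w'], of a] Tm by simp
  qed
qed (auto intro: der.nil)

lemma ider_Ter: "ider P (map Ter w) w"
  by (induction w) auto

lemma istep_ider:
  assumes "istep P s t" "ider P t w"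
  shows "ider P s w"
  using assms
proof (induction arbitrary: w rule: istep.induct)
  case (copy A \<alpha> u \<gamma> v)
  then obtain w1 w2 w3 where w: "w = w1 @ w2 @ w3" "ider P u w1" "ider P v w3"
    "der P \<alpha> \<gamma> (map Tm w2)" by (auto simp: ider_append dest: ider_inst)
  have "der P [NT A] \<gamma> (map Tm w2)" using der_singletonI(1)[OF copy(1) w(4)] .
  then show ?case using w by (auto simp: ider_append)
next
  case (push A B f u \<gamma> v)
  then obtain w1 w2 w3 where w: "w = w1 @ w2 @ w3" "ider P u w1" "ider P v w3"
    "der P [NT B] (f # \<gamma>) (map Tm w2)" by (auto simp: ider_append)
  have "der P [NT A] \<gamma> (map Tm w2)" using der_singletonI(2)[OF push(1) w(4)] .
  then show ?case using w by (auto simp: ider_append)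
next
  case (pop A f \<alpha> u \<gamma> v)
  then obtain w1 w2 w3 where w: "w = w1 @ w2 @ w3" "ider P u w1" "ider P v w3"
    "der P \<alpha> \<gamma> (map Tm w2)" by (auto simp: ider_append dest: ider_inst)
  have "der P [NT A] (f # \<gamma>) (map Tm w2)" using der_singletonI(3)[OF pop(1) w(4)] .
  then show ?case using w by (auto simp: ider_append)
qed

lemma ilang_iff_der: "x \<in> ilang P S \<longleftrightarrow> der P [NT S] [] (map Tm x)"
proof
  assume "x \<in> ilang P S"
  then have "(istep P)\<^sup>*\<^sup>* [Var S []] (map Ter x)" by (simp add: ilang_def)
  then have "ider P [Var S []] x"
    by (induction rule: converse_rtranclp_induct) (auto intro: ider_Ter istep_ider)
  then show "der P [NT S] [] (map Tm x)" by simp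
next
  assume "der P [NT S] [] (map Tm x)"
  then have "(istep P)\<^sup>*\<^sup>* [Var S []] (map (inst []) (map Tm x))" using der_isteps by fastforce
  then show "x \<in> ilang P S" by (simp add: ilang_def comp_def)
qed

section \<open>Productive words over a stack\<close>

text \<open>The flag \<open>b\<close> asks for a nonempty word. One predicate for both kinds of
  productivity lets the flags of combined contexts be joined by disjunction.\<close>

definition yields where
  "yields P \<gamma> b xs \<longleftrightarrow> (\<exists>w. der P xs \<gamma> (map Tm w) \<and> (b \<longrightarrow> w \<noteq> []))"

lemma yields_mono: "yields P \<gamma> b xs \<Longrightarrow> (b' \<Longrightarrow> b) \<Longrightarrow> yields P \<gamma> b' xs"
  unfolding yields_def by blast

lemma yields_Nil [simp]: "yields P \<gamma> b [] \<longleftrightarrow> \<not> b"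
proof -
  have "ys = []" if "der P [] \<gamma> ys" for ys using that by (rule der_NilE)
  then have "der P [] \<gamma> (map Tm w) \<longleftrightarrow> w = []" for w
    by (cases w) (auto intro: der.nil)
  then show ?thesis unfolding yields_def by auto
qed

lemma yields_append:
  "yields P \<gamma> b (xs @ ys) \<longleftrightarrow> yields P \<gamma> False xs \<and> yields P \<gamma> False ys \<and>
     (b \<longrightarrow> yields P \<gamma> True xs \<or> yields P \<gamma> True ys)" (is "?l \<longleftrightarrow> ?r")
proof
  assume ?l
  then obtain w where w: "der P (xs @ ys) \<gamma> (map Tm w)" "b \<longrightarrow> w \<noteq> []" by (auto simp: yields_def)
  obtain y1 y2 where y: "map Tm w = y1 @ y2" "der P xs \<gamma> y1" "der P ys \<gamma> y2"
    using der_appendD[OF w(1) refl] by blast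
  obtain w1 w2 where "w = w1 @ w2" "y1 = map Tm w1" "y2 = map Tm w2"
    using y(1) by (auto simp: map_eq_append_conv)
  then show ?r using y(2,3) w(2) unfolding yields_def by auto
next
  assume r: ?r
  then obtain w1 w2 where w: "der P xs \<gamma> (map Tm w1)" "der P ys \<gamma> (map Tm w2)" "b \<longrightarrow> w1 @ w2 \<noteq> []"
    unfolding yields_def append_is_Nil_conv by blast
  then have "der P (xs @ ys) \<gamma> (map Tm (w1 @ w2))" using der_append[OF w(1,2)] by simp
  then show ?l using \<open>b \<longrightarrow> w1 @ w2 \<noteq> []\<close> unfolding yields_def by blast
qed

lemma yields_Cons:
  "yields P \<gamma> b (X # ys) \<longleftrightarrow> yields P \<gamma> False [X] \<and> yields P \<gamma> False ys \<and>
     (b \<longrightarrow> yields P \<gamma> True [X] \<or> yields P \<gamma> True ys)"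
  using yields_append[of P \<gamma> b "[X]" ys] by simp

lemma yields_Tm [simp]: "yields P \<gamma> b [Tm a]"
  unfolding yields_def using der_Tm_singleton[of P a \<gamma>] by (intro exI[of _ "[a]"]) simp

text \<open>The symbols of \<open>xs\<close> derive their words independently, so only the set of
  symbols counts. Contexts can therefore be rearranged, and the productive nonterminals determine
  all productive words.\<close>

lemma yields_iff:
  "yields P \<gamma> b xs \<longleftrightarrow> (\<forall>X\<in>set xs. yields P \<gamma> False [X]) \<and> (b \<longrightarrow> (\<exists>X\<in>set xs. yields P \<gamma> True [X]))"
proof -
  have "(yields P \<gamma> False xs \<longleftrightarrow> (\<forall>X\<in>set xs. yields P \<gamma> False [X])) \<and>
    (yields P \<gamma> True xs \<longleftrightarrow> (\<forall>X\<in>set xs. yields P \<gamma> False [X]) \<and> (\<exists>X\<in>set xs. yields P \<gamma> True [X]))"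
  proof (induction xs)
    case (Cons X xs)
    show ?case
      using Cons yields_mono[of P \<gamma> True "[X]" False] yields_mono[of P \<gamma> True xs False]
        yields_Cons[of P \<gamma> True X xs] yields_Cons[of P \<gamma> False X xs]
      by (simp only: list.set ball_simps bex_simps simp_thms) blast
  qed simp
  then show ?thesis by (cases b) auto
qed

lemma yields_der:
  assumes "der P xs \<delta> ys" "yields P \<gamma> b ys"
  shows "yields P (\<delta> @ \<gamma>) b xs"
  using assms(2) der_comp[OF assms(1)] unfolding yields_def by blast

lemma yields_decomp:
  assumes "yields P (\<delta> @ \<gamma>) b xs"
  shows "\<exists>ys. der P xs \<delta> ys \<and> yields P \<gamma> b ys"
  using assms der_decomp[of P xs \<delta> \<gamma>] unfolding yields_def by blast

lemma yields_decomp2: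
  assumes "yields P (\<delta> @ \<gamma>) b (u @ v)"
  shows "\<exists>u' v'. der P u \<delta> u' \<and> der P v \<delta> v' \<and> yields P \<gamma> b (u' @ v')"
  using yields_decomp[OF assms] der_appendD[of P "u @ v" \<delta> _ u v] by blast

section \<open>Marked descents through the index stack\<close>

text \<open>\<open>down P \<gamma> X \<delta> Y b\<close>: the symbol X carrying the stack \<open>\<delta> @ \<gamma>\<close> has a
  descendant Y carrying \<open>\<gamma>\<close>, and everything beside the path can be completed to a terminal
  word, which can be chosen nonempty if b holds. \<open>up\<close> is the analogue for a descendant whose
  stack is longer by \<open>\<delta>\<close>.\<close>

definition down where
  "down P \<gamma> X \<delta> Y b \<longleftrightarrow> (\<exists>u v. der P [X] \<delta> (u @ Y # v) \<and> yields P \<gamma> b (u @ v))"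

definition up where
  "up P \<gamma> X \<delta> Y b \<longleftrightarrow> (\<exists>u v. (\<forall>z. der P [Y] \<delta> z \<longrightarrow> der P [X] [] (u @ z @ v)) \<and> yields P \<gamma> b (u @ v))"

lemma down_mono: "down P \<gamma> X \<delta> Y b \<Longrightarrow> (b' \<Longrightarrow> b) \<Longrightarrow> down P \<gamma> X \<delta> Y b'"
  unfolding down_def using yields_mono[of P \<gamma> b _ b'] by blast

lemma up_mono: "up P \<gamma> X \<delta> Y b \<Longrightarrow> (b' \<Longrightarrow> b) \<Longrightarrow> up P \<gamma> X \<delta> Y b'"
  unfolding up_def using yields_mono[of P \<gamma> b _ b'] by blast

lemma yields_context:
  assumes "yields P \<gamma> b (u @ v)" "yields P \<gamma> b' (u' @ v')"
  shows "yields P \<gamma> (b \<or> b') ((u @ u') @ (v' @ v))"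
proof -
  have "yields P \<gamma> (b \<or> b') xs" if "set xs = set (u @ v) \<union> set (u' @ v')" for xs
    using assms unfolding yields_iff[of P \<gamma> _ xs] yields_iff[of P \<gamma> _ "u @ v"]
      yields_iff[of P \<gamma> _ "u' @ v'"] that by blast
  from this[of "(u @ u') @ (v' @ v)"] show ?thesis by (simp add: Un_ac)
qed

lemma der_fill: "der P [Y] \<delta> z \<Longrightarrow> der P u \<delta> u' \<Longrightarrow> der P v \<delta> v' \<Longrightarrow> der P (u @ Y # v) \<delta> (u' @ z @ v')"
  using der_append[OF _ der_append[of P "[Y]" \<delta> z v v'], of u u'] by simp

text \<open>The context of the first path still carries \<delta> on top of \<gamma>. It is first
  derived down to \<gamma> so that it stays productive, and then joins the context of the second
  path.\<close>

lemma down_trans: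
  assumes "down P (\<delta> @ \<gamma>) X \<delta>' Y b" "down P \<gamma> Y \<delta> Z b'"
  shows "down P \<gamma> X (\<delta>' @ \<delta>) Z (b \<or> b')"
proof -
  obtain u v where u: "der P [X] \<delta>' (u @ Y # v)" "yields P (\<delta> @ \<gamma>) b (u @ v)"
    using assms(1) by (auto simp: down_def)
  obtain u2 v2 where u2: "der P u \<delta> u2" "der P v \<delta> v2" "yields P \<gamma> b (u2 @ v2)"
    using yields_decomp2[OF u(2)] by blast
  obtain u' v' where u': "der P [Y] \<delta> (u' @ Z # v')" "yields P \<gamma> b' (u' @ v')"
    using assms(2) by (auto simp: down_def)
  have "der P [X] (\<delta>' @ \<delta>) (u2 @ (u' @ Z # v') @ v2)"
    using der_comp[OF u(1) der_fill[OF u'(1) u2(1,2)]] .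
  then have "der P [X] (\<delta>' @ \<delta>) ((u2 @ u') @ Z # (v' @ v2))" by simp
  then show ?thesis using yields_context[OF u2(3) u'(2)] unfolding down_def by blast
qed

text \<open>The context \<open>u'\<close>, \<open>v'\<close> arises over the longer stack and has to
  shed \<delta> before it stands beside \<open>u\<close> and \<open>v\<close>. Correspondingly, a
  derivation of \<open>Z\<close> is cut between \<delta>' and \<delta>.\<close>

lemma up_trans:
  assumes "up P \<gamma> X \<delta> Y b" "up P (\<delta> @ \<gamma>) Y \<delta>' Z b'"
  shows "up P \<gamma> X (\<delta>' @ \<delta>) Z (b \<or> b')"
proof -
  obtain u v where u: "\<And>z. der P [Y] \<delta> z \<Longrightarrow> der P [X] [] (u @ z @ v)" "yields P \<gamma> b (u @ v)"
    using assms(1) by (auto simp: up_def)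
  obtain u' v' where u': "\<And>z. der P [Z] \<delta>' z \<Longrightarrow> der P [Y] [] (u' @ z @ v')"
    "yields P (\<delta> @ \<gamma>) b' (u' @ v')"
    using assms(2) by (auto simp: up_def)
  obtain u2 v2 where u2: "der P u' \<delta> u2" "der P v' \<delta> v2" "yields P \<gamma> b' (u2 @ v2)"
    using yields_decomp2[OF u'(2)] by blast
  have "der P [X] [] ((u @ u2) @ z @ (v2 @ v))" if z: "der P [Z] (\<delta>' @ \<delta>) z" for z
  proof -
    obtain z' where z': "der P [Z] \<delta>' z'" "der P z' \<delta> z" using der_decomp[OF z] by blast
    have "der P (u' @ z' @ v') \<delta> (u2 @ z @ v2)"
      by (intro der_append u2 z')
    from der_comp[OF u'(1)[OF z'(1)] this] have "der P [Y] \<delta> (u2 @ z @ v2)" by simp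
    from u(1)[OF this] show ?thesis by simp
  qed
  then show ?thesis using yields_context[OF u(2) u2(3)] unfolding up_def by blast
qed

lemma up_if_down: "down P \<gamma> X [] Y b \<Longrightarrow> up P \<gamma> X [] Y b"
proof -
  assume "down P \<gamma> X [] Y b"
  then obtain u v where u: "der P [X] [] (u @ Y # v)" "yields P \<gamma> b (u @ v)" by (auto simp: down_def)
  have "der P [X] [] (u @ z @ v)" if "der P [Y] [] z" for z
    using der_comp[OF u(1) der_fill[OF that der_refl der_refl]] by simp
  then show ?thesis using u(2) unfolding up_def by blast
qed

lemma down_refl: "down P \<gamma> X [] X False"
  unfolding down_def using der_refl[of P "[X]"] by (intro exI[of _ "[]"]) simp

lemma up_refl: "up P \<gamma> X [] X False"
  by (rule up_if_down) (rule down_refl)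

lemma up_push: "Push A B f \<in> P \<Longrightarrow> up P \<gamma> (NT A) [f] (NT B) False"
  unfolding up_def by (intro exI[of _ "[]"]) (auto intro: der_singletonI(2))

text \<open>A matched pair: on the way from \<open>X\<close> to \<open>Y\<close> the stack grows by
  \<delta> to reach \<open>X'\<close>, and \<open>Y'\<close> later pops \<delta> again. The
  branching demanded by \<open>b\<close> may lie on either side.\<close>

definition encl where
  "encl P \<gamma> X Y \<delta> X' Y' b \<longleftrightarrow> (\<exists>b1 b2. up P \<gamma> X \<delta> X' b1 \<and> down P \<gamma> Y' \<delta> Y b2 \<and> (b \<longrightarrow> b1 \<or> b2))"

lemma enclI: "up P \<gamma> X \<delta> X' b1 \<Longrightarrow> down P \<gamma> Y' \<delta> Y b2 \<Longrightarrow> (b \<Longrightarrow> b1 \<or> b2) \<Longrightarrow> encl P \<gamma> X Y \<delta> X' Y' b"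
  unfolding encl_def by blast

lemma encl_trans:
  assumes "encl P \<gamma> X Y \<delta> X' Y' b" "encl P (\<delta> @ \<gamma>) X' Y' \<delta>' X'' Y'' b'"
  shows "encl P \<gamma> X Y (\<delta>' @ \<delta>) X'' Y'' (b \<or> b')"
proof -
  obtain b1 b2 where 1: "up P \<gamma> X \<delta> X' b1" "down P \<gamma> Y' \<delta> Y b2" "b \<longrightarrow> b1 \<or> b2"
    using assms(1) unfolding encl_def by blast
  obtain b1' b2' where 2: "up P (\<delta> @ \<gamma>) X' \<delta>' X'' b1'" "down P (\<delta> @ \<gamma>) Y'' \<delta>' Y' b2'" "b' \<longrightarrow> b1' \<or> b2'"
    using assms(2) unfolding encl_def by blast
  show ?thesis using 1(3) 2(3)
    by (intro enclI[OF up_trans[OF 1(1) 2(1)] down_trans[OF 2(2) 1(2)]]) blast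
qed

lemma encl_refl: "encl P \<gamma> X Y [] X Y False"
  by (rule enclI[OF up_refl down_refl]) simp

lemma encl_mono: "encl P \<gamma> X Y \<delta> X' Y' b \<Longrightarrow> (b' \<Longrightarrow> b) \<Longrightarrow> encl P \<gamma> X Y \<delta> X' Y' b'"
  unfolding encl_def by blast

text \<open>A run leads from X to Y, both carrying \<open>\<gamma>\<close>, and never pops below \<open>\<gamma>\<close>; k counts branchings.
  In \<open>drun\<close> the symbol X carries \<open>\<gamma>\<close> and Y the empty stack.\<close>

inductive run :: "('n,'t,'i) prod set \<Rightarrow> 'i list \<Rightarrow> nat \<Rightarrow> ('n,'t) sym \<Rightarrow> ('n,'t) sym \<Rightarrow> bool" for P where
  triv: "run P \<gamma> 0 X X"
| step: "down P \<gamma> X [] Y b \<Longrightarrow> run P \<gamma> k Y Z \<Longrightarrow> run P \<gamma> (of_bool b + k) X Z"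
| block: "Push A B f \<in> P \<Longrightarrow> run P (f # \<gamma>) k1 (NT B) C \<Longrightarrow> down P \<gamma> C [f] Y b \<Longrightarrow> run P \<gamma> k2 Y Z
    \<Longrightarrow> run P \<gamma> (k1 + of_bool b + k2) (NT A) Z"

lemma down_push:
  assumes "Push A B f \<in> P" "down P (f # \<gamma>) (NT B) [] C b"  "down P \<gamma> C [f] Y b'"
  shows "down P \<gamma> (NT A) [] Y (b \<or> b')"
proof -
  have "down P \<gamma> (NT B) [f] Y (b \<or> b')" using down_trans[of P "[f]" \<gamma> "NT B" "[]" C b Y b'] assms by simp
  then show ?thesis unfolding down_def using der_singletonI(2)[OF assms(1), of "[]"] by blast
qed

text \<open>Every index pushed in a run is popped again within it, so a descent with unchanged stack
  remains; a single branching makes its context nonempty.\<close>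

lemma run_down: "run P \<gamma> k X Y \<Longrightarrow> down P \<gamma> X [] Y (k > 0)"
proof (induction rule: run.induct)
  case (triv \<gamma> X)
  then show ?case using down_refl by simp
next
  case (step \<gamma> X Y b k Z)
  have "down P \<gamma> X [] Z (b \<or> k > 0)"
    using down_trans[of P "[]" \<gamma> X "[]" Y b Z "k > 0"] step by simp
  then show ?case by (rule down_mono) (auto split: if_splits)
next
  case (block A B f \<gamma> k1 C Y b k2 Z)
  have "down P \<gamma> (NT A) [] Z ((k1 > 0 \<or> b) \<or> k2 > 0)"
    using down_trans[of P "[]" \<gamma> "NT A" "[]" Y "k1 > 0 \<or> b" Z "k2 > 0"] 
      down_push[OF block(1) block.IH(1) block(3)] block.IH(2) by simp
  then show ?case by (rule down_mono) (auto split: if_splits)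
qed

section \<open>Nested repetitions and pumping\<close>

definition prof where "prof P \<gamma> = (\<lambda>b. {A. yields P \<gamma> b [NT A]})"

lemma prof_yields: "prof P \<gamma> = prof P \<gamma>' \<Longrightarrow> yields P \<gamma> b xs \<longleftrightarrow> yields P \<gamma>' b xs"
proof -
  assume p: "prof P \<gamma> = prof P \<gamma>'"
  have "yields P \<gamma> b [X] \<longleftrightarrow> yields P \<gamma>' b [X]" for b X
    using fun_cong[OF p, of b] by (cases X) (auto simp: prof_def)
  then show ?thesis unfolding yields_iff[of P _ b xs] by simp
qed

text \<open>The repetition to be pumped: the pair \<open>X\<close>, \<open>Y\<close> recurs over the
  stack lengthened by \<delta>, with equal profiles and a branching between the two occurrences. The
  first conjunct embeds the outer pair in the whole path, the last one connects the two ends of the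
  inner pair.\<close>

definition pumpable where
  "pumpable P I F \<longleftrightarrow> (\<exists>\<gamma> \<delta> X Y. encl P [] I F \<gamma> X Y False \<and> encl P \<gamma> X Y \<delta> X Y True \<and>
     prof P (\<delta> @ \<gamma>) = prof P \<gamma> \<and> down P (\<delta> @ \<gamma>) X [] Y False)"

text \<open>A finite set containing every productive nonterminal, so that there are finitely many
  profiles even over an infinite type of nonterminals.\<close>

definition lhss :: "('n,'t,'i) prod set \<Rightarrow> 'n set" where
  "lhss P = (\<lambda>p. case p of Copy A _ \<Rightarrow> A | Push A _ _ \<Rightarrow> A | Pop A _ _ \<Rightarrow> A) ` P"

lemma yields_lhss: "yields P \<gamma> b [NT A] \<Longrightarrow> A \<in> lhss P"
proof -
  assume "yields P \<gamma> b [NT A]"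
  then obtain w where "der P [NT A] \<gamma> (map Tm w)" by (auto simp: yields_def)
  then show ?thesis
  proof (cases rule: der.cases)
    case (stop ys)
    then show ?thesis by (cases w) auto
  qed (force simp: lhss_def)+
qed

definition syms :: "('n,'t,'i) prod set \<Rightarrow> ('n,'t) sym set" where
  "syms P = (\<Union>p\<in>P. case p of Copy _ \<alpha> \<Rightarrow> set \<alpha> | Push _ B _ \<Rightarrow> {NT B} | Pop _ _ \<alpha> \<Rightarrow> set \<alpha>)"

lemma der_syms: "der P xs \<delta> ys \<Longrightarrow> syms P \<subseteq> V \<Longrightarrow> set xs \<subseteq> V \<Longrightarrow> set ys \<subseteq> V"
proof (induction rule: der.induct)
  case (copy A \<alpha> \<delta> y xs ys)
  then have "set \<alpha> \<subseteq> V" by (force simp: syms_def)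
  then show ?case using copy by simp
next
  case (push A B f \<delta> y xs ys)
  then have "NT B \<in> V" by (force simp: syms_def)
  then show ?case using push by simp
next
  case (pop A f \<alpha> \<delta> y xs ys)
  then have "set \<alpha> \<subseteq> V" by (force simp: syms_def)
  then show ?case using pop by simp
qed simp_all

lemma down_syms: "down P \<gamma> X \<delta> Y b \<Longrightarrow> syms P \<subseteq> V \<Longrightarrow> X \<in> V \<Longrightarrow> Y \<in> V"
  unfolding down_def using der_syms[of P "[X]" \<delta> _ V] by fastforce

lemma finite_syms: "finite P \<Longrightarrow> finite (syms P)"
  unfolding syms_def by (intro finite_UN_I) (auto split: prod.splits)

text \<open>The pigeonholes: the two ends of a run and the profile of its stack.\<close>

definition types where
  "types P V = V \<times> V \<times> {\<pi>. \<forall>b::bool. \<pi> b \<subseteq> lhss P}"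

lemma finite_types: "finite P \<Longrightarrow> finite V \<Longrightarrow> finite (types P V)"
proof -
  assume P: "finite P" "finite V"
  have "finite {\<pi>. \<forall>b::bool. (b \<in> UNIV \<longrightarrow> \<pi> b \<in> Pow (lhss P)) \<and> (b \<notin> UNIV \<longrightarrow> \<pi> b = {})}"
    using P by (intro finite_set_of_finite_funs) (auto simp: lhss_def)
  then show ?thesis using P unfolding types_def by (intro finite_cartesian_product) simp_all
qed

text \<open>The types in Q belong to blocks that strictly enclose the current one, so meeting
  one of them again gives a repetition.\<close>

definition nested where
  "nested P I F Q \<gamma> X Y \<longleftrightarrow> encl P [] I F \<gamma> X Y False \<and> (\<forall>X0 Y0 \<pi>. (X0, Y0, \<pi>) \<in> Q \<longrightarrow>
      (\<exists>\<gamma>0 \<delta>. \<gamma> = \<delta> @ \<gamma>0 \<and> prof P \<gamma>0 = \<pi> \<and>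
          encl P [] I F \<gamma>0 X0 Y0 False \<and> encl P \<gamma>0 X0 Y0 \<delta> X Y True))"

lemma nestedD:
  assumes "nested P I F Q \<gamma> X Y" "(X0, Y0, \<pi>) \<in> Q"
  obtains \<gamma>0 \<delta> where "\<gamma> = \<delta> @ \<gamma>0" "prof P \<gamma>0 = \<pi>" "encl P [] I F \<gamma>0 X0 Y0 False"
    "encl P \<gamma>0 X0 Y0 \<delta> X Y True"
  using assms unfolding nested_def by blast

lemma nested_encl:
  assumes n: "nested P I F Q \<gamma> X Y" and e: "encl P \<gamma> X Y \<delta> X' Y' b"
  shows "nested P I F Q (\<delta> @ \<gamma>) X' Y'"
  unfolding nested_def
proof (intro conjI allI impI)
  have "encl P \<gamma> X Y \<delta> X' Y' False" using e by (rule encl_mono) simp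
  then show "encl P [] I F (\<delta> @ \<gamma>) X' Y' False"
    using encl_trans[of P "[]" I F \<gamma> X Y False \<delta> X' Y' False] n by (simp add: nested_def)
  fix X0 Y0 \<pi> assume "(X0, Y0, \<pi>) \<in> Q"
  with n obtain \<gamma>0 \<delta>0 where g: "\<gamma> = \<delta>0 @ \<gamma>0" "prof P \<gamma>0 = \<pi>" "encl P [] I F \<gamma>0 X0 Y0 False"
    "encl P \<gamma>0 X0 Y0 \<delta>0 X Y True" by (rule nestedD)
  have "encl P \<gamma>0 X0 Y0 (\<delta> @ \<delta>0) X' Y' True"
    using encl_trans[OF g(4), of \<delta> X' Y' b] e g(1) by simp
  then show "\<exists>\<gamma>0 \<delta>'. \<delta> @ \<gamma> = \<delta>' @ \<gamma>0 \<and> prof P \<gamma>0 = \<pi> \<and>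
      encl P [] I F \<gamma>0 X0 Y0 False \<and> encl P \<gamma>0 X0 Y0 \<delta>' X' Y' True"
    using g by (intro exI[of _ \<gamma>0] exI[of _ "\<delta> @ \<delta>0"]) simp
qed

lemma nested_insert:
  assumes "nested P I F Q \<gamma> X Y" "encl P \<gamma> X Y \<delta> X' Y' True"
  shows "nested P I F (insert (X, Y, prof P \<gamma>) Q) (\<delta> @ \<gamma>) X' Y'"
  using nested_encl[OF assms] assms unfolding nested_def by blast

lemma pumpable_if_repetition:
  assumes "nested P I F Q \<gamma> X Y" "run P \<gamma> k X Y" "(X, Y, prof P \<gamma>) \<in> Q"
  shows "pumpable P I F"
proof -
  obtain \<gamma>0 \<delta> where g: "\<gamma> = \<delta> @ \<gamma>0" "prof P \<gamma>0 = prof P \<gamma>" "encl P [] I F \<gamma>0 X Y False"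
    "encl P \<gamma>0 X Y \<delta> X Y True" using nestedD[OF assms(1,3)] by blast
  have "down P \<gamma> X [] Y False" using run_down[OF assms(2)] by (rule down_mono) simp
  then have "prof P (\<delta> @ \<gamma>0) = prof P \<gamma>0 \<and> down P (\<delta> @ \<gamma>0) X [] Y False" using g(1,2) by simp
  then show ?thesis using g(3,4) unfolding pumpable_def by blast
qed

lemma type_of_run:
  assumes "syms P \<subseteq> V" "run P \<gamma> k X Y" "X \<in> V"
  shows "(X, Y, prof P \<gamma>) \<in> types P V"
proof -
  have "Y \<in> V" using down_syms[OF run_down[OF assms(2)] assms(1,3)] .
  moreover have "prof P \<gamma> b \<subseteq> lhss P" for b by (auto simp: prof_def intro: yields_lhss)
  ultimately show ?thesis using assms(3) by (simp add: types_def)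
qed

text \<open>Induction on the number of types outside \<open>Q\<close>. A run with
  \<open>2 ^ Suc n\<close> branchings splits into parts. If one part has all branchings, it is
  entered without recording a type. Otherwise some part has at least \<open>2 ^ n\<close> of them
  and a branching outside; then the type of the enclosing run is recorded, unless it lies in
  \<open>Q\<close> already and gives the repetition.\<close>

lemma pumpable_if_many_marks:
  fixes P :: "('n,'t,'i) prod set"
  assumes fin: "finite P" "finite V" and V: "syms P \<subseteq> V"
  shows "card (types P V - Q) \<le> n \<Longrightarrow> run P \<gamma> k X Y \<Longrightarrow> 2 ^ n \<le> k \<Longrightarrow> X \<in> V
    \<Longrightarrow> nested P I F Q \<gamma> X Y \<Longrightarrow> pumpable P I F"
proof (induction n arbitrary: Q \<gamma> k X Y)
  case 0
  then have "types P V - Q = {}" using finite_types[OF fin] by simp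
  then have "(X, Y, prof P \<gamma>) \<in> Q" using type_of_run[OF V 0(2,4)] by blast
  then show ?case by (rule pumpable_if_repetition[OF 0(5,2)])
next
  case (Suc n)
  have desc: "pumpable P I F" if "nested P I F Q \<gamma> X Y" "X \<in> V" "run P \<gamma> k X Y" "X' \<in> V"
    "run P (\<delta> @ \<gamma>) k' X' Y'" "2 ^ n \<le> k'" "encl P \<gamma> X Y \<delta> X' Y' True" for \<delta> \<gamma> k k' X Y X' Y'
  proof (cases "(X, Y, prof P \<gamma>) \<in> Q")
    case True
    then show ?thesis by (rule pumpable_if_repetition[OF that(1,3)])
  next
    case False
    have "types P V - insert (X, Y, prof P \<gamma>) Q \<subset> types P V - Q"
      using False type_of_run[OF V that(3,2)] by blast
    then have "card (types P V - insert (X, Y, prof P \<gamma>) Q) < card (types P V - Q)"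
      using finite_types[OF fin] by (intro psubset_card_mono) simp_all
    then have "card (types P V - insert (X, Y, prof P \<gamma>) Q) \<le> n" using Suc.prems(1) by linarith
    from Suc.IH[OF this that(5,6,4) nested_insert[OF that(1,7)]] show ?thesis .
  qed
  \<comment> \<open>The inner induction on the run handles the descents that pass no branching,
    where \<open>n\<close> cannot be lowered.\<close>
  have "run P \<gamma> k X Y \<Longrightarrow> 2 ^ Suc n \<le> k \<Longrightarrow> X \<in> V \<Longrightarrow> nested P I F Q \<gamma> X Y \<Longrightarrow> pumpable P I F"
    for \<gamma> k X Y
  proof (induction rule: run.induct)
    case (triv \<gamma> X)
    then show ?case by simp
  next
    case (step \<gamma> X Y b k Z)
    have YV: "Y \<in> V" using down_syms[OF step(1) V step.prems(2)] .
    have e: "encl P \<gamma> X Z [] Y Z b"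
      by (rule enclI[OF up_if_down[OF step(1)] down_refl]) simp
    show ?case
    proof (cases b)
      case False
      then have "2 ^ Suc n \<le> k" using step.prems(1) by simp
      then show ?thesis using step.IH[OF _ YV] nested_encl[OF step.prems(3) e, unfolded append_Nil] by blast
    next
      case True
      have p: "(1::nat) \<le> 2 ^ n" by simp
      have "2 * 2 ^ n \<le> Suc k" using step.prems(1) True by simp
      with p have "2 ^ n \<le> k" by linarith
      moreover have "encl P \<gamma> X Z [] Y Z True" using e True by simp
      ultimately show ?thesis
        using desc[OF step.prems(3,2) run.step[OF step(1,2)] YV, of "[]" k Z, unfolded append_Nil] step(2)
        by blast
    qed
  next
    case (block A B f \<gamma> k1 C Y b k2 Z)
    have BV: "NT B \<in> V" using V block(1) by (force simp: syms_def)
    have CV: "C \<in> V" using down_syms[OF run_down[OF block(2)] V BV] .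
    have YV: "Y \<in> V" using down_syms[OF block(3) V CV] .
    note r = run.block[OF block(1,2,3,4)]
    have d: "down P \<gamma> C [f] Z (b \<or> k2 > 0)"
      using down_trans[of P "[]" \<gamma> C "[f]" Y b Z "k2 > 0"] block(3) run_down[OF block(4)] by simp
    have e1: "encl P \<gamma> (NT A) Z [f] (NT B) C (b \<or> k2 > 0)"
      by (rule enclI[OF up_push[OF block(1)] d]) blast
    have "up P \<gamma> (NT A) [] Y (k1 > 0 \<or> b)"
      by (rule up_if_down[OF down_push[OF block(1) run_down[OF block(2)] block(3)]])
    then have e2: "encl P \<gamma> (NT A) Z [] Y Z (k1 > 0 \<or> b)"
      by (rule enclI[OF _ down_refl]) blast
    note n1 = nested_encl[OF block.prems(3) e1, unfolded append.simps]
      and n2 = nested_encl[OF block.prems(3) e2, unfolded append_Nil]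
    \<comment> \<open>If both parts had fewer than \<open>2 ^ n\<close> branchings, their sum plus
      the one at the pop would be at most \<open>2 * 2 ^ n - 1\<close>.\<close>
    have "2 * 2 ^ n \<le> Suc (k1 + k2)"
    proof -
      have "k1 + of_bool b + k2 \<le> Suc (k1 + k2)" by simp
      then show ?thesis using block.prems(1) by simp
    qed
    then have "2 ^ n \<le> k1 \<or> 2 ^ n \<le> k2" by linarith
    \<comment> \<open>Either the inner run or the rest after the pop is entered; the descent is
      marked as soon as something branches outside that part.\<close>
    then consider "\<not> (b \<or> k2 > 0)" | "b \<or> k2 > 0" "2 ^ n \<le> k1" | "\<not> (k1 > 0 \<or> b)" | "k1 > 0 \<or> b" "2 ^ n \<le> k2"
      by blast
    then show ?case
    proof cases
      case 1
      then have "2 ^ Suc n \<le> k1" using block.prems(1) by simp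
      then show ?thesis using block.IH(1)[OF _ BV n1] by blast
    next
      case 2
      have "encl P \<gamma> (NT A) Z [f] (NT B) C True" using e1 2(1) by simp
      then show ?thesis
        using desc[OF block.prems(3,2) r BV, of "[f]" k1 C, unfolded append.simps] block(2) 2(2) by blast
    next
      case 3
      then have "2 ^ Suc n \<le> k2" using block.prems(1) by simp
      then show ?thesis using block.IH(2)[OF _ YV n2] by blast
    next
      case 4
      have "encl P \<gamma> (NT A) Z [] Y Z True" using e2 4(1) by simp
      then show ?thesis
        using desc[OF block.prems(3,2) r YV, of "[]" k2 Z, unfolded append_Nil] block(4) 4(2) by blast
    qed
  qed
  then show ?case using Suc.prems(2-5) by blast
qed

section \<open>Branching paths in derivations of long words\<close>

inductive drun :: "('n,'t,'i) prod set \<Rightarrow> 'i list \<Rightarrow> nat \<Rightarrow> ('n,'t) sym \<Rightarrow> ('n,'t) sym \<Rightarrow> bool" for P where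
  base: "run P [] k X Y \<Longrightarrow> drun P [] k X Y"
| pop: "run P (f # \<gamma>) k1 X C \<Longrightarrow> down P \<gamma> C [f] Y b \<Longrightarrow> drun P \<gamma> k2 Y Z
    \<Longrightarrow> drun P (f # \<gamma>) (k1 + of_bool b + k2) X Z"

inductive_cases drun_ConsE: "drun P (f # \<gamma>) k X Z"

lemma drun_step:
  assumes "drun P \<gamma> k Y Z" "down P \<gamma> X [] Y b"
  shows "drun P \<gamma> (of_bool b + k) X Z"
  using assms
proof (cases rule: drun.cases)
  case base
  then show ?thesis using drun.base[OF run.step] assms(2) by blast
next
  case (pop f \<gamma>' k1 C Y' b' k2)
  have "run P (f # \<gamma>') (of_bool b + k1) X C" using run.step[of P \<gamma> X Y b k1 C] assms(2) pop by blast
  from drun.pop[OF this pop(4,5)] show ?thesis using pop by (simp add: add.assoc)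
qed

text \<open>The level of \<open>f\<close> together with its pop becomes one block at the start of
  the run on the level below.\<close>

lemma drun_push:
  assumes "Push A B f \<in> P" "drun P (f # \<gamma>) k (NT B) Z"
  shows "drun P \<gamma> k (NT A) Z"
proof -
  obtain k1 C Y b k2 where 1: "k = k1 + of_bool b + k2" "run P (f # \<gamma>) k1 (NT B) C"
    "down P \<gamma> C [f] Y b" "drun P \<gamma> k2 Y Z"
    using assms(2) by (rule drun_ConsE)
  from 1(4) show ?thesis
  proof (cases rule: drun.cases)
    case base
    then have "run P [] (k1 + of_bool b + k2) (NT A) Z"
      using run.block[OF assms(1), of "[]" k1 C Y b k2 Z] 1(2,3) by simp
    then show ?thesis unfolding base(1) 1(1) by (rule drun.base)
  next
    case (pop f' \<gamma>' k1' C' Y' b' k2')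
    have "run P (f' # \<gamma>') (k1 + of_bool b + k1') (NT A) C'"
      using run.block[OF assms(1), of "f' # \<gamma>'" k1 C Y b k1' C'] 1(2,3) pop(3) pop(1) by simp
    from drun.pop[OF this pop(4,5)] show ?thesis using pop(1,2) 1(1) by (simp add: add.assoc)
  qed
qed

lemma down_Tm: "down P \<gamma> (Tm a) \<delta> (Tm a) False"
  unfolding down_def by (intro exI[of _ "[]"] conjI) (simp_all add: der_Tm_singleton)

text \<open>A terminal derives itself over every stack. Letting it pop the remaining indices, with a
  trivial run on each level, ends every path on the empty stack.\<close>

lemma drun_Tm: "drun P \<gamma> 0 (Tm a) (Tm a)"
proof (induction \<gamma>)
  case Nil
  show ?case by (rule drun.base[OF run.triv])
next
  case (Cons f \<gamma>)
  from drun.pop[OF run.triv down_Tm Cons] show ?case by simp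
qed

lemma down_copy: "Copy A (p @ Y # q) \<in> P \<Longrightarrow> yields P \<gamma> b (p @ q) \<Longrightarrow> down P \<gamma> (NT A) [] Y b"
  unfolding down_def using der_singletonI(1)[OF _ der_refl, of A "p @ Y # q" P] by blast

lemma down_pop: "Pop A f (p @ Y # q) \<in> P \<Longrightarrow> yields P \<gamma> b (p @ q) \<Longrightarrow> down P \<gamma> (NT A) [f] Y b"
  unfolding down_def using der_singletonI(3)[OF _ der_refl, of A f "p @ Y # q" P] by blast

text \<open>The bound \<open>d ^ k\<close> converts the length of a word into branchings along a
  single path from \<open>X\<close> to a terminal.\<close>

definition marked where
  "marked P d \<gamma> X w \<longleftrightarrow> der P [X] \<gamma> (map Tm w) \<and>
     (w \<noteq> [] \<longrightarrow> (\<exists>k a. drun P \<gamma> k X (Tm a) \<and> length w \<le> d ^ k))"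

lemma length_concat_le:
  assumes "\<forall>x\<in>set ws. length x \<le> m"
  shows "length (concat ws) \<le> length ws * m"
  using assms by (induction ws) auto

text \<open>The path continues into a child with a longest word. If another child has a nonempty
  word, a branching is counted and the length drops by a factor of at most \<open>d\<close>;
  otherwise this child accounts for the whole word.\<close>

lemma marked_branch:
  assumes m: "list_all2 (marked P d \<gamma>) \<alpha> ws" and d: "length \<alpha> \<le> d" "1 \<le> d" and ne: "concat ws \<noteq> []"
  shows "\<exists>p Y q b k a. \<alpha> = p @ Y # q \<and> yields P \<gamma> b (p @ q) \<and> drun P \<gamma> k Y (Tm a) \<and>
     length (concat ws) \<le> d ^ (of_bool b + k)"
proof -
  have len: "length \<alpha> = length ws" using m by (rule list_all2_lengthD)
  have mk: "marked P d \<gamma> (\<alpha> ! j) (ws ! j)" if "j < length ws" for j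
    using list_all2_nthD[OF m] that len by simp
  let ?M = "Max (length ` set ws)"
  have "ws \<noteq> []" using ne by auto
  then have "?M \<in> length ` set ws" by (intro Max_in) auto
  then obtain i where i: "i < length ws" "length (ws ! i) = ?M" by (auto simp: in_set_conv_nth)
  have le: "\<forall>x\<in>set ws. length x \<le> length (ws ! i)" unfolding i(2) by simp
  have wi: "ws ! i \<noteq> []" using le ne by auto
  define b where "b \<longleftrightarrow> (\<exists>j < length ws. j \<noteq> i \<and> ws ! j \<noteq> [])"
  define p where "p = take i \<alpha>"
  define q where "q = drop (Suc i) \<alpha>"
  have \<alpha>: "\<alpha> = p @ \<alpha> ! i # q" using i(1) len by (simp add: p_def q_def id_take_nth_drop)
  have setpq: "set (p @ q) = {\<alpha> ! j | j. j < length ws \<and> j \<noteq> i}"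
  proof -
    have "set p = (!) \<alpha> ` {0..<i}" using i(1) len by (simp add: p_def nth_image)
    then have p: "set p = {\<alpha> ! j | j. j < i}" by auto
    have q: "set q = {\<alpha> ! j | j. i < j \<and> j < length ws}"
    proof (intro equalityI subsetI)
      fix Z assume "Z \<in> set q"
      then obtain m where "m < length ws - Suc i" "Z = \<alpha> ! (Suc i + m)"
        using len i(1) by (auto simp: q_def in_set_conv_nth)
      then show "Z \<in> {\<alpha> ! j | j. i < j \<and> j < length ws}" by (intro CollectI exI[of _ "Suc i + m"]) auto
    next
      fix Z assume "Z \<in> {\<alpha> ! j | j. i < j \<and> j < length ws}"
      then obtain j where j: "Z = \<alpha> ! j" "i < j" "j < length ws" by blast
      then have "q ! (j - Suc i) = Z" "j - Suc i < length q" using len i(1) by (simp_all add: q_def)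
      then show "Z \<in> set q" using nth_mem by metis
    qed
    show ?thesis unfolding set_append p q using i(1) by (auto simp: nat_neq_iff)
  qed
  have yl: "yields P \<gamma> b' [\<alpha> ! j]" if "j < length ws" "b' \<longrightarrow> ws ! j \<noteq> []" for j b'
    using mk[OF that(1)] that(2) unfolding marked_def yields_def by blast
  have "\<forall>X\<in>set (p @ q). yields P \<gamma> False [X]"
    unfolding setpq using yl[of _ False] by blast
  moreover have "b \<longrightarrow> (\<exists>X\<in>set (p @ q). yields P \<gamma> True [X])"
    unfolding setpq b_def using yl[of _ True] by blast
  ultimately have yb: "yields P \<gamma> b (p @ q)" unfolding yields_iff[of P \<gamma> b] by blast
  obtain k a where k: "drun P \<gamma> k (\<alpha> ! i) (Tm a)" "length (ws ! i) \<le> d ^ k"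
    using mk[OF i(1)] wi unfolding marked_def by blast
  have "length (concat ws) \<le> d ^ (of_bool b + k)"
  proof (cases b)
    case True
    have "length (concat ws) \<le> length ws * length (ws ! i)" using le by (rule length_concat_le)
    also have "\<dots> \<le> d * d ^ k" using d(1) len k(2) by (intro mult_le_mono) simp_all
    finally show ?thesis using True by simp
  next
    case False
    have E: "ws ! j = []" if "j < length ws" "j \<noteq> i" for j
      using False that unfolding b_def by blast
    have "\<forall>x\<in>set (take i ws). x = []"
      using E i(1) by (simp add: nth_image[symmetric])
    moreover have "\<forall>x\<in>set (drop (Suc i) ws). x = []"
    proof
      fix x assume "x \<in> set (drop (Suc i) ws)"
      then obtain m where "m < length ws - Suc i" "x = ws ! (Suc i + m)"
        using i(1) by (auto simp: in_set_conv_nth)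
      then show "x = []" using E[of "Suc i + m"] by simp
    qed
    ultimately have "\<forall>x\<in>set (take i ws). x = []" "\<forall>x\<in>set (drop (Suc i) ws). x = []" by blast+
    then have "concat (take i ws) = []" "concat (drop (Suc i) ws) = []" by simp_all
    moreover have "concat ws = concat (take i ws) @ ws ! i @ concat (drop (Suc i) ws)"
      using id_take_nth_drop[OF i(1)] by (metis concat.simps(2) concat_append)
    ultimately have "concat ws = ws ! i" by (simp only: append_Nil append_Nil2)
    then show ?thesis using False k(2) by simp
  qed
  then show ?thesis using \<alpha> yb k(1) by blast
qed

text \<open>The paths are built from the leaves upward: a terminal has length 1, the value of
  \<open>d ^ 0\<close>; a push extends the path of its only child; copies and pops choose a child by
  \<open>marked_branch\<close>.\<close>

lemma der_marked:
  assumes d: "1 \<le> d" "\<And>A \<alpha>. Copy A \<alpha> \<in> P \<Longrightarrow> length \<alpha> \<le> d" "\<And>A f \<alpha>. Pop A f \<alpha> \<in> P \<Longrightarrow> length \<alpha> \<le> d"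
  shows "der P xs \<gamma> ys \<Longrightarrow> ys = map Tm w \<Longrightarrow> \<exists>ws. list_all2 (marked P d \<gamma>) xs ws \<and> concat ws = w"
proof (induction arbitrary: w rule: der.induct)
  case (nil \<delta>)
  then show ?case by simp
next
  case (tm xs \<delta> ys a)
  then obtain w' where w: "w = a # w'" "ys = map Tm w'" by auto
  then obtain ws where ws: "list_all2 (marked P d \<delta>) xs ws" "concat ws = w'" using tm.IH by blast
  have "marked P d \<delta> (Tm a) [a]" unfolding marked_def
    using der_Tm_singleton drun_Tm by (intro conjI impI exI[of _ 0] exI[of _ a]) simp_all
  then show ?case using ws w(1) by (intro exI[of _ "[a] # ws"]) simp
next
  case (stop xs ys A)
  then show ?case by auto
next
  case (copy A \<alpha> \<delta> y xs ys)
  obtain w1 w2 where w: "w = w1 @ w2" "y = map Tm w1" "ys = map Tm w2"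
    using copy.prems by (auto simp: append_eq_map_conv)
  obtain ws1 ws2 where ws: "list_all2 (marked P d \<delta>) \<alpha> ws1" "concat ws1 = w1"
    "list_all2 (marked P d \<delta>) xs ws2" "concat ws2 = w2" using copy.IH w by blast
  have "marked P d \<delta> (NT A) w1" unfolding marked_def
  proof (intro conjI impI)
    show "der P [NT A] \<delta> (map Tm w1)" using der_singletonI(1)[OF copy.hyps(1,2)] w(2) by simp
    assume "w1 \<noteq> []"
    then obtain p Y q b k a where "\<alpha> = p @ Y # q" "yields P \<delta> b (p @ q)" "drun P \<delta> k Y (Tm a)"
      "length w1 \<le> d ^ (of_bool b + k)"
      using marked_branch[OF ws(1) d(2)[OF copy.hyps(1)] d(1)] ws(2) by blast
    then show "\<exists>k a. drun P \<delta> k (NT A) (Tm a) \<and> length w1 \<le> d ^ k"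
      using drun_step[OF _ down_copy[of A p Y q]] copy.hyps(1) by blast
  qed
  then show ?case using ws w(1) by (intro exI[of _ "w1 # ws2"]) simp
next
  case (push A B f \<delta> y xs ys)
  obtain w1 w2 where w: "w = w1 @ w2" "y = map Tm w1" "ys = map Tm w2"
    using push.prems by (auto simp: append_eq_map_conv)
  obtain ws1 ws2 where ws: "list_all2 (marked P d (f # \<delta>)) [NT B] ws1" "concat ws1 = w1"
    "list_all2 (marked P d \<delta>) xs ws2" "concat ws2 = w2" using push.IH w by blast
  have m: "marked P d (f # \<delta>) (NT B) w1" using ws(1,2) by (auto simp: list_all2_Cons1)
  have "marked P d \<delta> (NT A) w1" unfolding marked_def
  proof (intro conjI impI)
    show "der P [NT A] \<delta> (map Tm w1)" using der_singletonI(2)[OF push.hyps(1,2)] w(2) by simp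
    assume "w1 \<noteq> []"
    then show "\<exists>k a. drun P \<delta> k (NT A) (Tm a) \<and> length w1 \<le> d ^ k"
      using m drun_push[OF push.hyps(1)] unfolding marked_def by blast
  qed
  then show ?case using ws w(1) by (intro exI[of _ "w1 # ws2"]) simp
next
  case (pop A f \<alpha> \<delta> y xs ys)
  obtain w1 w2 where w: "w = w1 @ w2" "y = map Tm w1" "ys = map Tm w2"
    using pop.prems by (auto simp: append_eq_map_conv)
  obtain ws1 ws2 where ws: "list_all2 (marked P d \<delta>) \<alpha> ws1" "concat ws1 = w1"
    "list_all2 (marked P d (f # \<delta>)) xs ws2" "concat ws2 = w2" using pop.IH w by blast
  have "marked P d (f # \<delta>) (NT A) w1" unfolding marked_def
  proof (intro conjI impI)
    show "der P [NT A] (f # \<delta>) (map Tm w1)" using der_singletonI(3)[OF pop.hyps(1,2)] w(2) by simp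
    assume "w1 \<noteq> []"
    then obtain p Y q b k a where b: "\<alpha> = p @ Y # q" "yields P \<delta> b (p @ q)" "drun P \<delta> k Y (Tm a)"
      "length w1 \<le> d ^ (of_bool b + k)"
      using marked_branch[OF ws(1) d(3)[OF pop.hyps(1)] d(1)] ws(2) by blast
    have "down P \<delta> (NT A) [f] Y b" using down_pop[of A f p Y q P \<delta> b] pop.hyps(1) b(1,2) by simp
    from drun.pop[OF run.triv this b(3)]
    show "\<exists>k a. drun P (f # \<delta>) k (NT A) (Tm a) \<and> length w1 \<le> d ^ k" using b(4) by auto
  qed
  then show ?case using ws w(1) by (intro exI[of _ "w1 # ws2"]) simp
qed

text \<open>With \<open>d\<close> bounding the right-hand sides and \<open>n\<close> types, a word
  longer than \<open>d ^ 2 ^ n\<close> needs a path with at least \<open>2 ^ n\<close> branchings,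
  enough for a repetition when no type is recorded at the start.\<close>

lemma pumpable_if_unbounded:
  fixes P :: "('n,'t,'i) prod set"
  assumes fin: "finite P" and unb: "\<And>m. \<exists>x\<in>ilang P S. m < length x"
  shows "\<exists>a. pumpable P (NT S) (Tm a)"
proof -
  define rl :: "('n,'t,'i) prod \<Rightarrow> nat" where
    "rl = (\<lambda>p. case p of Copy _ \<alpha> \<Rightarrow> length \<alpha> | Push _ _ _ \<Rightarrow> 1 | Pop _ _ \<alpha> \<Rightarrow> length \<alpha>)"
  define d where "d = Max (insert 1 (rl ` P))"
  have rl: "rl p \<le> d" if "p \<in> P" for p using fin that by (simp add: d_def)
  have d: "1 \<le> d" using fin by (simp add: d_def)
  have dC: "length \<alpha> \<le> d" if "Copy A \<alpha> \<in> P" for A \<alpha> using rl[OF that] by (simp add: rl_def)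
  have dP: "length \<alpha> \<le> d" if "Pop A f \<alpha> \<in> P" for A f \<alpha> using rl[OF that] by (simp add: rl_def)
  define V where "V = insert (NT S) (syms P)"
  define n where "n = card (types P V)"
  obtain x where x: "x \<in> ilang P S" "d ^ 2 ^ n < length x" using unb by blast
  have "\<exists>ws. list_all2 (marked P d []) [NT S] ws \<and> concat ws = x"
    by (rule der_marked[OF d dC dP x(1)[unfolded ilang_iff_der] refl])
  then obtain ws where ws: "list_all2 (marked P d []) [NT S] ws" "concat ws = x" by blast
  then have "marked P d [] (NT S) x" by (auto simp: list_all2_Cons1)
  moreover have "x \<noteq> []" using x(2) by auto
  ultimately obtain k a where k: "drun P [] k (NT S) (Tm a)" "length x \<le> d ^ k"
    unfolding marked_def by blast
  have r: "run P [] k (NT S) (Tm a)" using k(1) by (cases rule: drun.cases) simp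
  have "2 ^ n \<le> k"
  proof (rule ccontr)
    assume "\<not> 2 ^ n \<le> k"
    then have "d ^ k \<le> d ^ 2 ^ n" using d by (intro power_increasing) simp_all
    then show False using x(2) k(2) by simp
  qed
  moreover have "nested P (NT S) (Tm a) {} [] (NT S) (Tm a)" by (simp add: nested_def encl_refl)
  moreover have "finite V" "syms P \<subseteq> V" "NT S \<in> V" using finite_syms[OF fin] by (auto simp: V_def)
  moreover have "card (types P V - {}) \<le> n" by (simp add: n_def)
  ultimately have "pumpable P (NT S) (Tm a)" using pumpable_if_many_marks[OF fin] r by blast
  then show ?thesis by blast
qed

section \<open>Pumping the repeated stack segment\<close>

lemma der_singletonwise:
  assumes "\<forall>Z\<in>set xs. der P [Z] \<delta> (f Z)"
  shows "der P xs \<delta> (hext f xs)"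
  using assms
proof (induction xs)
  case Nil
  show ?case by (simp add: der.nil)
next
  case (Cons Z xs)
  then show ?case using der_ConsI[of P Z \<delta> "f Z" xs "hext f xs"] by simp
qed

lemma concat_replicate_Suc: "concat (replicate (Suc n) x) = concat (replicate n x) @ x"
  by (induction n) auto

text \<open>The markers \<open>Inl True\<close> and \<open>Inl False\<close> sit at the two ends of the word and collect
  the contexts u and v of the pumped push phase; without them the nth iterate would list these
  contexts in the reverse order.\<close>

lemma iterated_subset_if_pumpable:
  fixes P :: "('n,'t,'i) prod set"
  assumes fin: "finite P" and pump: "pumpable P (NT S) (Tm a)"
  shows "\<exists>(A :: (bool + ('n,'t) sym) set) h g w. finite A \<and> (\<forall>b\<in>A. set (h b) \<subseteq> A) \<and> set w \<subseteq> A \<and>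
    (\<forall>n. concat (map g ((hext h ^^ n) w)) \<in> ilang P S \<and> n \<le> length (concat (map g ((hext h ^^ n) w))))"
proof -
  obtain \<gamma> \<delta> X Y where p: "encl P [] (NT S) (Tm a) \<gamma> X Y False" "encl P \<gamma> X Y \<delta> X Y True"
     "prof P (\<delta> @ \<gamma>) = prof P \<gamma>" "down P (\<delta> @ \<gamma>) X [] Y False"
    using pump unfolding pumpable_def by blast
  note pr = prof_yields[OF p(3)]
  obtain b b' where o: "up P [] (NT S) \<gamma> X b" "down P [] Y \<gamma> (Tm a) b'"
    using p(1) unfolding encl_def by blast
  have "up P [] (NT S) \<gamma> X False" using o(1) by (rule up_mono) simp
  then obtain u0 v0 where out: "\<And>z. der P [X] \<gamma> z \<Longrightarrow> der P [NT S] [] (u0 @ z @ v0)"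
    and y0: "yields P [] False (u0 @ v0)" unfolding up_def by blast
  obtain s t where s: "der P [Y] \<gamma> (s @ Tm a # t)" "yields P [] b' (s @ t)"
    using o(2) unfolding down_def by blast
  \<comment> \<open>The terminal at the end of the path makes the word nonempty, hence
    \<open>Y\<close> derives a nonempty word over \<gamma>.\<close>
  have "yields P [] True (s @ Tm a # t)"
    using s(2) unfolding yields_append[of P "[]" _ s] yields_Cons[of P "[]" _ "Tm a" t] by simp
  from yields_der[OF s(1) this] have yY: "yields P \<gamma> True [Y]" by simp
  obtain b1 b2 where b: "up P \<gamma> X \<delta> X b1" "down P \<gamma> Y \<delta> Y b2" and b12: "b1 \<or> b2"
    using p(2) unfolding encl_def by blast
  obtain u v where uv: "\<And>z. der P [X] \<delta> z \<Longrightarrow> der P [X] [] (u @ z @ v)" and yuv: "yields P \<gamma> b1 (u @ v)"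
    using b(1) unfolding up_def by blast
  obtain u' v' where Y: "der P [Y] \<delta> (u' @ Y # v')" and yuv': "yields P \<gamma> b2 (u' @ v')"
    using b(2) unfolding down_def by blast
  obtain c1 c2 where c: "der P [X] [] (c1 @ Y # c2)" and "yields P (\<delta> @ \<gamma>) False (c1 @ c2)"
    using p(4) unfolding down_def by blast
  then have yc: "yields P \<gamma> False (c1 @ c2)" using pr by blast
  have yF: "yields P \<gamma> False xs" if "yields P \<gamma> b xs" for b xs using that by (rule yields_mono) simp
  \<comment> \<open>For each productive symbol, a derivation through \<delta> that keeps both kinds
    of productivity. It exists because \<gamma> and \<open>\<delta> @ \<gamma>\<close> have the same
    profile.\<close>
  define \<beta> where "\<beta> = (\<lambda>Z. SOME ys. der P [Z] \<delta> ys \<and> (\<forall>b. yields P \<gamma> b [Z] \<longrightarrow> yields P \<gamma> b ys))"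
  have \<beta>: "der P [Z] \<delta> (\<beta> Z) \<and> (\<forall>b. yields P \<gamma> b [Z] \<longrightarrow> yields P \<gamma> b (\<beta> Z))"
    if "yields P \<gamma> False [Z]" for Z
  proof -
    have "yields P \<gamma> (yields P \<gamma> True [Z]) [Z]" using that by (cases "yields P \<gamma> True [Z]") simp_all
    then have "yields P (\<delta> @ \<gamma>) (yields P \<gamma> True [Z]) [Z]" using pr by blast
    then obtain ys where ys: "der P [Z] \<delta> ys" "yields P \<gamma> (yields P \<gamma> True [Z]) ys"
      using yields_decomp by blast
    have "yields P \<gamma> b [Z] \<longrightarrow> yields P \<gamma> b ys" for b
      using ys(2) yF[OF ys(2)] by (cases b; cases "yields P \<gamma> True [Z]") simp_all
    then have "\<exists>ys. der P [Z] \<delta> ys \<and> (\<forall>b. yields P \<gamma> b [Z] \<longrightarrow> yields P \<gamma> b ys)" using ys(1) by blast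
    then show ?thesis unfolding \<beta>_def by (rule someI_ex)
  qed
  \<comment> \<open>\<open>Y\<close> uses its recurrence from the repetition instead, so that every
    iteration adds images of \<open>u'\<close> and \<open>v'\<close> around it.\<close>
  define k where "k = (\<lambda>Z. if Z = Y then u' @ Y # v' else \<beta> Z)"
  have yYY: "yields P \<gamma> b (u' @ Y # v')" for b
    using yuv' yY yF[OF yY] yF[OF yuv'] unfolding yields_append[of P \<gamma> _ u'] yields_Cons[of P \<gamma> _ Y v']
    by blast
  have k: "der P [Z] \<delta> (k Z) \<and> (\<forall>b. yields P \<gamma> b [Z] \<longrightarrow> yields P \<gamma> b (k Z))"
    if "yields P \<gamma> False [Z]" for Z
  proof (cases "Z = Y")
    case True
    then show ?thesis using Y yYY by (simp add: k_def)
  next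
    case False
    then show ?thesis using \<beta>[OF that] by (simp add: k_def)
  qed
  have letters: "yields P \<gamma> False [Z]" if "yields P \<gamma> b xs" "Z \<in> set xs" for Z b xs
    using that unfolding yields_iff[of P \<gamma> b xs] by blast
  have ky: "yields P \<gamma> b (hext k xs)" if xs: "yields P \<gamma> b xs" for b xs
  proof -
    have "yields P \<gamma> False [Z]" if Z: "Z \<in> set (hext k xs)" for Z
    proof -
      obtain W where W: "W \<in> set xs" "Z \<in> set (k W)" using Z by (auto simp: set_hext)
      have "yields P \<gamma> False (k W)" using k[OF letters[OF xs W(1)]] letters[OF xs W(1)] by blast
      then show ?thesis using W(2) by (rule letters)
    qed
    moreover have "\<exists>Z\<in>set (hext k xs). yields P \<gamma> True [Z]" if b
    proof -
      obtain W where W: "W \<in> set xs" "yields P \<gamma> True [W]"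
        using xs \<open>b\<close> unfolding yields_iff[of P \<gamma> b xs] by blast
      have "yields P \<gamma> True (k W)" using k[OF letters[OF xs W(1)]] W(2) by blast
      then obtain Z where "Z \<in> set (k W)" "yields P \<gamma> True [Z]"
        unfolding yields_iff[of P \<gamma> True "k W"] by blast
      then show ?thesis using W(1) unfolding set_hext by blast
    qed
    ultimately show ?thesis unfolding yields_iff[of P \<gamma> b "hext k xs"] by blast
  qed
  have kyn: "yields P \<gamma> b ((hext k ^^ n) xs)" if "yields P \<gamma> b xs" for b xs n
    using that by (induction n) (simp_all add: ky)
  have kd: "der P xs \<delta> (hext k xs)" if "yields P \<gamma> b xs" for b xs
    using k letters[OF that] by (intro der_singletonwise) blast
  have kdn: "der P xs (concat (replicate n \<delta>)) ((hext k ^^ n) xs)" if "yields P \<gamma> b xs" for b xs n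
  proof (induction n)
    case 0
    show ?case using der_refl[of P xs] by simp
  next
    case (Suc n)
    show ?case unfolding concat_replicate_Suc
      using der_comp[OF Suc kd[OF kyn[OF that]]] by simp
  qed
  \<comment> \<open>Terminal words over \<gamma>, nonempty wherever possible, so that strongly
    productive contexts add length.\<close>
  define gs where "gs = (\<lambda>Z. SOME w. der P [Z] \<gamma> (map Tm w) \<and> (yields P \<gamma> True [Z] \<longrightarrow> w \<noteq> []))"
  have gs: "der P [Z] \<gamma> (map Tm (gs Z)) \<and> (yields P \<gamma> True [Z] \<longrightarrow> gs Z \<noteq> [])"
    if "yields P \<gamma> False [Z]" for Z
  proof -
    have "\<exists>w. der P [Z] \<gamma> (map Tm w) \<and> (yields P \<gamma> True [Z] \<longrightarrow> w \<noteq> [])"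
      using that unfolding yields_def by blast
    then show ?thesis unfolding gs_def by (rule someI_ex)
  qed
  define G where "G = (\<lambda>xs. concat (map gs xs))"
  have G_app: "G (xs @ ys) = G xs @ G ys" for xs ys by (simp add: G_def)
  have Gd: "der P xs \<gamma> (map Tm (G xs))" if "yields P \<gamma> b xs" for b xs
  proof -
    have "der P xs \<gamma> (hext (\<lambda>Z. map Tm (gs Z)) xs)"
      using gs letters[OF that] by (intro der_singletonwise) blast
    moreover have "hext (\<lambda>Z. map Tm (gs Z)) xs = map Tm (G xs)" by (induction xs) (simp_all add: G_def)
    ultimately show ?thesis by simp
  qed
  have Gne: "0 < length (G xs)" if xs: "yields P \<gamma> True xs" for xs
  proof -
    obtain Z where Z: "Z \<in> set xs" "yields P \<gamma> True [Z]"
      using xs unfolding yields_iff[of P \<gamma> True xs] by blast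
    then have "gs Z \<noteq> []" using gs[OF letters[OF xs]] by blast
    then show ?thesis using Z(1) by (auto simp: G_def)
  qed
  obtain y z where yz: "der P u0 [] (map Tm y)" "der P v0 [] (map Tm z)"
    using y0 unfolding yields_append[of P "[]" _ u0] yields_def[of P "[]" False] by blast
  define h :: "bool + ('n,'t) sym \<Rightarrow> (bool + ('n,'t) sym) list" where
    "h = (\<lambda>l. case l of Inl e \<Rightarrow> if e then Inl True # map Inr u else map Inr v @ [Inl False]
       | Inr Z \<Rightarrow> map Inr (k Z))"
  define g where "g = (\<lambda>l. case l of Inl e \<Rightarrow> if e then y else z | Inr Z \<Rightarrow> gs Z)"
  have hI: "hext h (map Inr xs) = map Inr (hext k xs)" for xs by (induction xs) (simp_all add: h_def)
  have hIn: "(hext h ^^ n) (map Inr xs) = map Inr ((hext k ^^ n) xs)" for n xs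
    by (induction n) (simp_all add: hI)
  have gI: "concat (map g (map Inr xs)) = G xs" for xs by (induction xs) (simp_all add: g_def G_def)
  \<comment> \<open>\<open>un\<close> consists of \<open>u\<close> and its first
    \<open>n - 1\<close> iterates under \<open>k\<close> in increasing order, \<open>vn\<close> of
    those of \<open>v\<close> in decreasing order: a context produced over more copies of \<delta>
    has to pass through all of them.\<close>
  have ends: "\<exists>un vn. (hext h ^^ n) [Inl True] = Inl True # map Inr un \<and>
      (hext h ^^ n) [Inl False] = map Inr vn @ [Inl False] \<and> yields P \<gamma> False (un @ vn) \<and>
      (\<forall>zz. der P [X] (concat (replicate n \<delta>)) zz \<longrightarrow> der P [X] [] (un @ zz @ vn))" for n
  proof (induction n)
    case 0
    show ?case by (intro exI[of _ "[]"]) simp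
  next
    case (Suc n)
    then obtain un vn where n: "(hext h ^^ n) [Inl True] = Inl True # map Inr un"
      "(hext h ^^ n) [Inl False] = map Inr vn @ [Inl False]" "yields P \<gamma> False (un @ vn)"
      "\<And>zz. der P [X] (concat (replicate n \<delta>)) zz \<Longrightarrow> der P [X] [] (un @ zz @ vn)" by blast
    have yuvn: "yields P \<gamma> False un" "yields P \<gamma> False vn"
      using n(3) unfolding yields_append[of P \<gamma> False un] by blast+
    have "der P [X] [] ((u @ hext k un) @ zz @ (hext k vn @ v))"
      if zz: "der P [X] (concat (replicate (Suc n) \<delta>)) zz" for zz
    proof -
      \<comment> \<open>The lowest copy of \<delta> is split off. The other \<open>n\<close> pushes
        take place above it, so \<open>k\<close> is applied to their contexts, while the first push
        contributes \<open>u\<close> and \<open>v\<close>.\<close>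
      obtain z1 where z1: "der P [X] (concat (replicate n \<delta>)) z1" "der P z1 \<delta> zz"
        using der_decomp[of P "[X]" "concat (replicate n \<delta>)" \<delta> zz] zz
        unfolding concat_replicate_Suc by blast
      have "der P (un @ z1 @ vn) \<delta> (hext k un @ zz @ hext k vn)"
        using der_append[OF kd[OF yuvn(1)] der_append[OF z1(2) kd[OF yuvn(2)]]] .
      from der_comp[OF n(4)[OF z1(1)] this]
      have "der P [X] \<delta> (hext k un @ zz @ hext k vn)" by simp
      from uv[OF this] show ?thesis by simp
    qed
    moreover have "yields P \<gamma> False ((u @ hext k un) @ (hext k vn @ v))"
      using yF[OF yuv] ky[OF yuvn(1)] ky[OF yuvn(2)] unfolding yields_append[of P \<gamma> False] by blast
    moreover have "(hext h ^^ Suc n) [Inl True] = Inl True # map Inr (u @ hext k un)"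
      using n(1) by (simp add: hI) (simp add: h_def)
    moreover have "(hext h ^^ Suc n) [Inl False] = map Inr (hext k vn @ v) @ [Inl False]"
      using n(2) by (simp add: hI) (simp add: h_def)
    ultimately show ?case by blast
  qed
  \<comment> \<open>\<open>c1 @ Y # c2\<close> arises where the path turns from pushing to
    popping.\<close>
  define w :: "(bool + ('n,'t) sym) list" where "w = [Inl True] @ map Inr (c1 @ Y # c2) @ [Inl False]"
  have ycY: "yields P \<gamma> False (c1 @ Y # c2)"
    using yc yF[OF yY] unfolding yields_append[of P \<gamma> False c1] yields_Cons[of P \<gamma> False Y c2] by blast
  have hw: "(hext h ^^ n) w = (hext h ^^ n) [Inl True] @ map Inr ((hext k ^^ n) (c1 @ Y # c2)) @
      (hext h ^^ n) [Inl False]" for n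
    unfolding w_def hext_pow_append[of n h] hIn ..
  have inL: "concat (map g ((hext h ^^ n) w)) \<in> ilang P S" for n
  proof -
    let ?c = "(hext k ^^ n) (c1 @ Y # c2)"
    obtain un vn where n: "(hext h ^^ n) [Inl True] = Inl True # map Inr un"
      "(hext h ^^ n) [Inl False] = map Inr vn @ [Inl False]" "yields P \<gamma> False (un @ vn)"
      "\<And>zz. der P [X] (concat (replicate n \<delta>)) zz \<Longrightarrow> der P [X] [] (un @ zz @ vn)"
      using ends[of n] by blast
    have img: "concat (map g ((hext h ^^ n) w)) = y @ G (un @ ?c @ vn) @ z"
      unfolding hw n(1,2) using gI by (simp add: G_app) (simp add: g_def)
    have "der P [X] (concat (replicate n \<delta>)) ?c" using der_comp[OF c kdn[OF ycY]] by simp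
    then have d: "der P [X] [] (un @ ?c @ vn)" by (rule n(4))
    have "yields P \<gamma> False (un @ ?c @ vn)"
      using n(3) kyn[OF ycY, of n] unfolding yields_append[of P \<gamma> False] by blast
    from der_comp[OF d Gd[OF this]] have "der P [X] \<gamma> (map Tm (G (un @ ?c @ vn)))" by simp
    from out[OF this] have "der P [NT S] [] (u0 @ map Tm (G (un @ ?c @ vn)) @ v0)" .
    from der_comp[OF this der_append[OF yz(1) der_append[OF der_refl yz(2)]]]
    have "der P [NT S] [] (map Tm (y @ G (un @ ?c @ vn) @ z))" by simp
    then show ?thesis unfolding img ilang_iff_der .
  qed
  let ?len = "\<lambda>n x. length (concat (map g ((hext h ^^ n) x)))"
  \<comment> \<open>The branching lies either in the push phase, where each iteration adds images of
    \<open>u\<close> and \<open>v\<close> next to the markers, or in the pop phase, where each adds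
    images of \<open>u'\<close> and \<open>v'\<close> around \<open>Y\<close>.\<close>
  have len: "n \<le> ?len n w" for n
  proof (cases b1)
    case True
    have "n \<le> ?len n [Inl True] + ?len n [Inl False]"
    proof (induction n)
      case (Suc n)
      have "(hext h ^^ Suc n) [Inl True] = (hext h ^^ n) [Inl True] @ map Inr ((hext k ^^ n) u)"
        using hext_pow_Cons[of n h "Inl True" "map Inr u"]
        by (simp only: hext_pow_Suc_right hIn) (simp add: h_def)
      moreover have "(hext h ^^ Suc n) [Inl False] = map Inr ((hext k ^^ n) v) @ (hext h ^^ n) [Inl False]"
        using hext_pow_append[of n h "map Inr v" "[Inl False]"]
        by (simp only: hext_pow_Suc_right hIn) (simp add: h_def)
      moreover have "1 \<le> length (G ((hext k ^^ n) u)) + length (G ((hext k ^^ n) v))"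
        using Gne[OF kyn[of True "u @ v" n]] yuv True
        unfolding hext_pow_append G_app length_append by (simp add: Suc_le_eq)
      ultimately show ?case using Suc
        by (simp del: funpow.simps map_map add: gI)
    qed simp
    then show ?thesis unfolding hw[of n] by (simp del: map_map)
  next
    case False
    then have b2 using b12 by simp
    have Yn: "n \<le> length (G ((hext k ^^ n) [Y]))" for n
    proof (induction n)
      case (Suc n)
      have "(hext k ^^ Suc n) [Y] = (hext k ^^ n) u' @ (hext k ^^ n) [Y] @ (hext k ^^ n) v'"
        using hext_pow_append[of n k u' "Y # v'"] hext_pow_Cons[of n k Y v']
        by (simp only: hext_pow_Suc_right) (simp add: k_def)
      moreover have "1 \<le> length (G ((hext k ^^ n) u')) + length (G ((hext k ^^ n) v'))"
        using Gne[OF kyn[of True "u' @ v'" n]] yuv' \<open>b2\<close>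
        unfolding hext_pow_append G_app length_append by (simp add: Suc_le_eq)
      ultimately show ?case using Suc
        by (simp del: funpow.simps add: G_app)
    qed simp
    have "(hext k ^^ n) (c1 @ Y # c2) = (hext k ^^ n) c1 @ (hext k ^^ n) [Y] @ (hext k ^^ n) c2"
      using hext_pow_append[of n k c1 "Y # c2"] hext_pow_Cons[of n k Y c2] by simp
    then show ?thesis unfolding hw[of n] using Yn[of n] gI by (simp del: map_map add: G_app)
  qed
  define R where "R = {A. yields P \<gamma> False [NT A]}"
  \<comment> \<open>The type of terminals may be infinite, so the alphabet is built from the
    productive nonterminals and the finitely many words in use. It is closed under \<open>k\<close>
    since a terminal derives only itself.\<close>
  define Z0 where "Z0 = set (u @ v) \<union> set (u' @ v') \<union> set (c1 @ Y # c2) \<union> NT ` R \<union> (\<Union>A\<in>R. set (k (NT A)))"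
  have finR: "finite R"
  proof (rule finite_subset)
    show "R \<subseteq> lhss P" by (auto simp: R_def intro: yields_lhss)
    show "finite (lhss P)" using fin by (simp add: lhss_def)
  qed
  have Z0: "yields P \<gamma> False [Z]" if Z: "Z \<in> Z0" for Z
  proof -
    have R: "yields P \<gamma> False (k (NT A))" if "A \<in> R" for A using k[of "NT A"] that by (simp add: R_def)
    consider "Z \<in> set (u @ v)" | "Z \<in> set (u' @ v')" | "Z \<in> set (c1 @ Y # c2)" | A where "A \<in> R" "Z = NT A"
      | A where "A \<in> R" "Z \<in> set (k (NT A))"
      using Z unfolding Z0_def by blast
    then show ?thesis
    proof cases
      case 1
      then show ?thesis by (rule letters[OF yuv])
    next
      case 2
      then show ?thesis by (rule letters[OF yuv'])
    next
      case 3
      then show ?thesis by (rule letters[OF ycY])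
    next
      case 4
      then show ?thesis by (simp add: R_def)
    next
      case 5
      then show ?thesis using letters[OF R] by blast
    qed
  qed
  have kZ0: "set (k Z) \<subseteq> Z0" if "Z \<in> Z0" for Z
  proof (cases Z)
    case (NT A)
    then have "A \<in> R" using Z0[OF that] by (simp add: R_def)
    then show ?thesis unfolding NT Z0_def by (rule le_supI2[OF UN_upper])
  next
    case (Tm a)
    have "der P [Tm a] \<delta> (k Z)" using k[OF Z0[OF that]] Tm by simp
    then have "k Z = [Z]" using Tm by (simp add: der_Tm_singletonD)
    then show ?thesis using that by simp
  qed
  define A where "A = {Inl True, Inl False} \<union> Inr ` Z0"
  have "finite A" using finR by (simp add: A_def Z0_def)
  moreover have "\<forall>b\<in>A. set (h b) \<subseteq> A"
  proof
    fix b assume "b \<in> A"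
    then show "set (h b) \<subseteq> A"
    proof (cases b)
      case (Inl e)
      then show ?thesis by (cases e) (auto simp: h_def A_def Z0_def)
    next
      case (Inr Z)
      then show ?thesis using kZ0[of Z] \<open>b \<in> A\<close> by (auto simp: h_def A_def)
    qed
  qed
  moreover have "set w \<subseteq> A" by (auto simp: w_def A_def Z0_def)
  ultimately show ?thesis using inL len
    by (intro exI[of _ A] exI[of _ h] exI[of _ g] exI[of _ w] conjI allI)
qed

section \<open>Determined words are morphic\<close>

lemma morphic_if_determined:
  fixes \<alpha> :: "nat \<Rightarrow> 't"
  assumes L: "indexed_language L" "determines L \<alpha>"
  shows "morphic \<alpha>"
proof -
  obtain P :: "(nat,'t,nat) prod set" and S where P: "finite P" "L = ilang P S"
    using L(1) unfolding indexed_language_def by blast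
  have pre: "is_prefix_of_word x \<alpha>" if "x \<in> ilang P S" for x
    using L(2) that P(2) by (auto simp: determines_def)
  have "\<exists>x\<in>ilang P S. m < length x" for m
  proof (rule ccontr)
    assume "\<not> (\<exists>x\<in>ilang P S. m < length x)"
    \<comment> \<open>A prefix of \<alpha> is given by its length, so bounded lengths would make
      \<open>L\<close> finite.\<close>
    then have "L \<subseteq> (\<lambda>n. map \<alpha> [0..<n]) ` {..m}"
    proof (intro subsetI)
      fix x assume x: "x \<in> L"
      have "x = map \<alpha> [0..<length x]"
        using pre[of x] x P(2) by (intro nth_equalityI) (auto simp: is_prefix_of_word_def)
      moreover have "length x \<le> m" using x P(2) \<open>\<not> (\<exists>x\<in>ilang P S. m < length x)\<close> by (meson not_le)
      ultimately show "x \<in> (\<lambda>n. map \<alpha> [0..<n]) ` {..m}" by blast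
    qed
    then have "finite L" by (rule finite_subset) simp
    then show False using L(2) by (simp add: determines_def)
  qed
  from pumpable_if_unbounded[OF P(1) this] obtain a where "pumpable P (NT S) (Tm a)" by blast
  from iterated_subset_if_pumpable[OF P(1) this]
  obtain A :: "(bool + (nat, 't) sym) set" and h g w where
    "finite A" "\<forall>b\<in>A. set (h b) \<subseteq> A" "set w \<subseteq> A"
    "\<And>n. concat (map g ((hext h ^^ n) w)) \<in> ilang P S"
    "\<And>n. n \<le> length (concat (map g ((hext h ^^ n) w)))" by blast
  then show ?thesis using pre by (intro morphic_if_prefixes_iterated[of A h w g \<alpha>]) simp_all
qed

section \<open>Grammars for morphic words\<close>

text \<open>The grammar for the converse builds the stack \<open>1 ^ n 0\<close> under the nonterminal 1 and then
  applies the morphism once for every popped 1, the symbol b being encoded as the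
  nonterminal \<open>b + 2\<close>. The bottom index 0 forces all symbols to stop at the same time.\<close>

definition morphic_grammar ::
    "nat set \<Rightarrow> (nat \<Rightarrow> nat list) \<Rightarrow> (nat \<Rightarrow> 't) \<Rightarrow> nat \<Rightarrow> (nat,'t,nat) prod set" where
  "morphic_grammar A h e a = {Push 0 1 0, Push 1 1 1, Copy 1 [NT (a + 2)]} \<union>
     (\<lambda>b. Pop (b + 2) 1 (map (\<lambda>c. NT (c + 2)) (h b))) ` A \<union> (\<lambda>b. Pop (b + 2) 0 [Tm (e b)]) ` A"

lemma morphic_grammar_iff:
  "Copy B \<alpha> \<in> morphic_grammar A h e a \<longleftrightarrow> B = 1 \<and> \<alpha> = [NT (a + 2)]"
  "Push B C f \<in> morphic_grammar A h e a \<longleftrightarrow> C = 1 \<and> (B = 0 \<and> f = 0 \<or> B = 1 \<and> f = 1)"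
  "Pop B f \<alpha> \<in> morphic_grammar A h e a \<longleftrightarrow> (\<exists>b\<in>A. B = b + 2 \<and>
     (f = 1 \<and> \<alpha> = map (\<lambda>c. NT (c + 2)) (h b) \<or> f = 0 \<and> \<alpha> = [Tm (e b)]))"
  by (auto simp: morphic_grammar_def)

lemma replicate_stack_cases:
  "f # \<gamma> = replicate n 1 @ [0::nat] \<Longrightarrow> f = 0 \<and> \<gamma> = [] \<and> n = 0 \<or>
     f = 1 \<and> (\<exists>m. n = Suc m \<and> \<gamma> = replicate m 1 @ [0])"
  by (cases n) auto

lemma der_morphic_grammar_letters:
  assumes hA: "\<forall>b\<in>A. set (h b) \<subseteq> A"
  shows "set x \<subseteq> A \<Longrightarrow> der (morphic_grammar A h e a) (map (\<lambda>c. NT (c + 2)) x) (replicate n 1 @ [0])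
    (map Tm (map e ((hext h ^^ n) x)))"
proof (induction n arbitrary: x)
  case 0
  have bottom: "der (morphic_grammar A h e a) [NT (b + 2)] [0] [Tm (e b)]" if "b \<in> A" for b
    by (rule der_singletonI(3)[OF _ der_refl]) (use that in \<open>auto simp: morphic_grammar_iff\<close>)
  have "der (morphic_grammar A h e a) (map (\<lambda>c. NT (c + 2)) x) [0] (map Tm (map e x))" using 0
  proof (induction x)
    case (Cons b x)
    then have "der (morphic_grammar A h e a) (map (\<lambda>c. NT (c + 2)) x) [0] (map Tm (map e x))" by simp
    from der_ConsI[OF bottom this, of b] Cons.prems show ?case by simp
  qed (simp add: der.nil)
  then show ?case by simp
next
  case (Suc n)
  have step: "der (morphic_grammar A h e a) [NT (b + 2)] [1] (map (\<lambda>c. NT (c + 2)) (h b))" if "b \<in> A" for b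
    by (rule der_singletonI(3)[OF _ der_refl]) (use that in \<open>auto simp: morphic_grammar_iff\<close>)
  have "der (morphic_grammar A h e a) (map (\<lambda>c. NT (c + 2)) x) [1] (map (\<lambda>c. NT (c + 2)) (hext h x))"
    using Suc.prems
  proof (induction x)
    case (Cons b x)
    then have "der (morphic_grammar A h e a) (map (\<lambda>c. NT (c + 2)) x) [1]
        (map (\<lambda>c. NT (c + 2)) (hext h x))" by simp
    from der_ConsI[OF step this, of b] Cons.prems show ?case by simp
  qed (simp add: der.nil)
  moreover have "set (hext h x) \<subseteq> A" using hA Suc.prems by (auto simp: set_hext)
  ultimately have "der (morphic_grammar A h e a) (map (\<lambda>c. NT (c + 2)) x) ([1] @ replicate n 1 @ [0])
      (map Tm (map e ((hext h ^^ n) (hext h x))))"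
    using der_comp Suc.IH by blast
  then show ?case by (simp add: funpow_swap1)
qed

lemma morphic_grammar_generates:
  assumes hA: "\<forall>b\<in>A. set (h b) \<subseteq> A" and a: "a \<in> A"
  shows "map e ((hext h ^^ n) [a]) \<in> ilang (morphic_grammar A h e a) 0"
proof -
  let ?P = "morphic_grammar A h e a"
  have "der ?P [NT (a + 2)] (replicate n 1 @ [0]) (map Tm (map e ((hext h ^^ n) [a])))"
    using der_morphic_grammar_letters[OF hA, of "[a]" e a n] a by simp
  then have "der ?P [NT 1] (replicate n 1 @ [0]) (map Tm (map e ((hext h ^^ n) [a])))"
    by (rule der_singletonI(1)[rotated]) (simp add: morphic_grammar_iff)
  moreover have "der ?P [NT 1] (replicate n 1 @ [0]) z \<Longrightarrow> der ?P [NT 1] [0] z" for z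
  proof (induction n)
    case (Suc n)
    have "der ?P [NT 1] (replicate n 1 @ [0]) z"
      by (rule der_singletonI(2)[of 1 1 1]) (use Suc.prems in \<open>simp_all add: morphic_grammar_iff\<close>)
    then show ?case by (rule Suc.IH)
  qed simp
  ultimately have "der ?P [NT 1] [0] (map Tm (map e ((hext h ^^ n) [a])))" by blast
  then have "der ?P [NT 0] [] (map Tm (map e ((hext h ^^ n) [a])))"
    by (rule der_singletonI(2)[rotated]) (simp add: morphic_grammar_iff)
  then show ?thesis by (simp only: ilang_iff_der)
qed

section \<open>Words generated by the grammar\<close>

text \<open>The only word a letter symbol can derive over the stack \<open>1 ^ n 0\<close>;
  subtracting 2 undoes the encoding of letters.\<close>

definition letter_value :: "(nat \<Rightarrow> nat list) \<Rightarrow> (nat \<Rightarrow> 't) \<Rightarrow> nat \<Rightarrow> (nat,'t) sym \<Rightarrow> 't list" where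
  "letter_value h e n X = (case X of NT c \<Rightarrow> map e ((hext h ^^ n) [c - 2]) | Tm t \<Rightarrow> [t])"

lemma concat_letter_value:
  "concat (map (letter_value h e n) (map (\<lambda>c. NT (c + 2)) x)) = map e ((hext h ^^ n) x)"
proof (induction x)
  case (Cons b x)
  then show ?case using hext_pow_Cons[of n h b x] by (simp add: letter_value_def)
qed simp

text \<open>Nonterminals from 2 on have only pops, and the top index leaves no choice between them.
  The stack forces \<open>n\<close> applications of \<open>h\<close> followed by
  \<open>e\<close>.\<close>

lemma morphic_grammar_letters_value:
  "der (morphic_grammar A h e a) xs \<gamma> ys \<Longrightarrow> ys = map Tm w \<Longrightarrow> \<gamma> = replicate n 1 @ [0] \<Longrightarrow>
    (\<forall>X\<in>set xs. \<forall>c. X = NT c \<longrightarrow> 2 \<le> c) \<Longrightarrow> w = concat (map (letter_value h e n) xs)"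
proof (induction arbitrary: n w rule: der.induct)
  case (nil \<delta>)
  then show ?case by simp
next
  case (tm xs \<delta> ys t)
  then obtain w' where w: "w = t # w'" "ys = map Tm w'" by auto
  then show ?case using tm.IH[OF w(2) tm.prems(2)] tm.prems(3) by (simp add: letter_value_def)
next
  case (stop xs ys B)
  then show ?case by simp
next
  case (copy B \<alpha> \<delta> y xs ys)
  have "B = 1" using copy.hyps(1) by (auto simp: morphic_grammar_iff)
  then show ?case using copy.prems(3) by simp
next
  case (push B C f \<delta> y xs ys)
  have "B < 2" using push.hyps(1) by (auto simp: morphic_grammar_iff)
  then show ?case using push.prems(3) by simp
next
  case (pop B f \<alpha> \<delta> y xs ys)
  obtain w1 w2 where w: "w = w1 @ w2" "y = map Tm w1" "ys = map Tm w2"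
    using pop.prems(1) by (auto simp: append_eq_map_conv)
  have w2: "w2 = concat (map (letter_value h e n) xs)"
    using pop.IH(2)[OF w(3) pop.prems(2)] pop.prems(3) by simp
  consider (bottom) b where "B = b + 2" "f = 0" "\<alpha> = [Tm (e b)]"
    | (letter) b where "B = b + 2" "f = 1" "\<alpha> = map (\<lambda>c. NT (c + 2)) (h b)"
    using pop.hyps(1) by (auto simp: morphic_grammar_iff)
  then have "w1 = letter_value h e n (NT B)"
  proof cases
    case bottom
    have "n = 0" using replicate_stack_cases[OF pop.prems(2)] bottom(2) by auto
    have "y = [Tm (e b)]" using pop.hyps(2) unfolding bottom(3) by (rule der_Tm_singletonD)
    then have "w1 = [e b]" using w(2) by (cases w1) auto
    then show ?thesis using bottom(1) \<open>n = 0\<close> by (simp add: letter_value_def)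
  next
    case letter
    obtain m where m: "n = Suc m" "\<delta> = replicate m 1 @ [0]"
      using replicate_stack_cases[OF pop.prems(2)] letter(2) by auto
    have "w1 = concat (map (letter_value h e m) \<alpha>)"
      using pop.IH(1)[OF w(2) m(2)] letter(3) by auto
    then have "w1 = map e ((hext h ^^ m) (h b))" unfolding letter(3) concat_letter_value .
    then show ?thesis using letter(1) m(1)
      by (simp add: letter_value_def hext_pow_Suc_right del: funpow.simps)
  qed
  then show ?case using w(1) w2 by simp
qed

text \<open>The nonterminal 1 can only push another 1 or pass to the letter \<open>a\<close>; the
  exponent \<open>m\<close> is the number of ones on the stack at that moment.\<close>

lemma morphic_grammar_start_value:
  "der (morphic_grammar A h e a) xs \<gamma> ys \<Longrightarrow> xs = [NT 1] \<Longrightarrow> ys = map Tm w \<Longrightarrow>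
    \<gamma> = replicate n 1 @ [0] \<Longrightarrow> \<exists>m. w = map e ((hext h ^^ m) [a])"
proof (induction arbitrary: n rule: der.induct)
  case (copy B \<alpha> \<delta> y xs ys)
  have \<alpha>: "\<alpha> = map (\<lambda>c. NT (c + 2)) [a]" using copy.hyps(1) by (auto simp: morphic_grammar_iff)
  have "ys = []" using copy.hyps(3) copy.prems(1) by (auto elim: der_NilE)
  then have "y = map Tm w" using copy.prems(2) by simp
  then have "w = concat (map (letter_value h e n) \<alpha>)"
    using \<alpha> by (intro morphic_grammar_letters_value[OF copy.hyps(2) _ copy.prems(3)]) auto
  then show ?case unfolding \<alpha> concat_letter_value by blast
next
  case (push B C f \<delta> y xs ys)
  have C: "C = 1" "f = 1" using push.hyps(1) push.prems(1) by (auto simp: morphic_grammar_iff)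
  have "ys = []" using push.hyps(3) push.prems(1) by (auto elim: der_NilE)
  then have "y = map Tm w" using push.prems(2) by simp
  then show ?case using push.IH(1)[of "Suc n"] C push.prems(3) by simp
next
  case (pop B f \<alpha> \<delta> y xs ys)
  then show ?case by (auto simp: morphic_grammar_iff)
qed auto

lemma der_start:
  assumes "der P [NT B] [] (map Tm w)" "\<And>\<alpha>. Copy B \<alpha> \<notin> P"
    "\<And>C f. Push B C f \<in> P \<Longrightarrow> C = D \<and> f = g"
  shows "der P [NT D] [g] (map Tm w)"
  using assms(1)
proof (cases rule: der.cases)
  case (stop ys)
  then show ?thesis by auto
next
  case (copy \<alpha> y ys)
  then show ?thesis using assms(2) by blast
next
  case (push C f y ys)
  have "ys = []" using push(4) by (rule der_NilE)
  then show ?thesis using push(1,3) assms(3)[OF push(2)] by simp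
qed

lemma morphic_grammar_words:
  assumes "w \<in> ilang (morphic_grammar A h e a) 0"
  shows "\<exists>m. w = map e ((hext h ^^ m) [a])"
proof -
  have "der (morphic_grammar A h e a) [NT 1] [0] (map Tm w)"
    using assms[unfolded ilang_iff_der] by (rule der_start) (auto simp: morphic_grammar_iff)
  then show ?thesis using morphic_grammar_start_value[of A h e a "[NT 1]" "[0]" "map Tm w" w 0] by simp
qed

lemma determined_if_morphic:
  fixes \<alpha> :: "nat \<Rightarrow> 't"
  assumes "morphic \<alpha>"
  shows "\<exists>L. indexed_language L \<and> determines L \<alpha>"
proof -
  obtain A h a and e :: "nat \<Rightarrow> 't" where A: "finite A" "a \<in> A" "\<forall>b\<in>A. set (h b) \<subseteq> A" "prolongable h a"
    "\<alpha> = (\<lambda>i. e (omega_iter h a i))"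
    using assms unfolding morphic_def by blast
  let ?L = "ilang (morphic_grammar A h e a) 0"
  have "finite (morphic_grammar A h e a)" using A(1) by (simp add: morphic_grammar_def)
  then have "indexed_language ?L" unfolding indexed_language_def by blast
  moreover have "infinite ?L"
  proof
    assume fin: "finite ?L"
    let ?n = "Max (length ` ?L)"
    have "length (map e ((hext h ^^ ?n) [a])) \<le> ?n"
      using fin imageI[OF morphic_grammar_generates[OF A(3,2), of e ?n], of length] by (intro Max_ge) simp_all
    then show False using prolongable_length[OF A(4), of ?n] by simp
  qed
  moreover have "\<forall>x\<in>?L. is_prefix_of_word x \<alpha>"
  proof
    fix x assume "x \<in> ?L"
    then obtain m where "x = map e ((hext h ^^ m) [a])" using morphic_grammar_words by blast
    then show "is_prefix_of_word x \<alpha>"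
      using is_prefix_omega_iter[OF A(4), of m] unfolding A(5) by (simp add: is_prefix_of_word_def)
  qed
  ultimately show ?thesis unfolding determines_def by blast
qed

theorem theorem4:
  fixes \<alpha> :: "nat \<Rightarrow> 't"
  shows "(\<exists>L. indexed_language L \<and> determines L \<alpha>) \<longleftrightarrow> morphic \<alpha>"
  using morphic_if_determined determined_if_morphic by blast

end
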